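(* Let $X$ be a nonnegative local submartingale which decomposes as $X_t=N_t+A_t$, where $N$ is a càdlàg local martingale with $N_0=0$ and $A$ is a continuous increasing process with $A_0=0$. Let $X_t^*=\sup_{s\le t}X_s$. Then for any $k\in(0,1)$, $$\mathbb{E}\big[(X_\infty^* )^k\big]\le\frac{2-k}{1-k}\,\mathbb{E}\big[A_\infty^k\big].$$ If furthermore the process $(X_t^* )$ is continuous (this is the case if $X$ has only negative jumps), then for any $k\in(0,1)$, $$\mathbb{E}\big[(X_\infty^* )^k\big]\le\frac{2-k}{1-k}\,\mathbb{E}\big[A_\infty^k\big]\le\left(\frac{2-k}{1-k}\right)^2\mathbb{E}\big[(X_\infty^* )^k\big].$$
   Context: All processes are defined on a filtered probability space satisfying the usual conditions; "increasing" means nondecreasing (and adapted). "Only negative jumps" means $X_t-X_{t-}\le0$ for all $t>0$. $X_\infty^*=\sup_{s\ge0}X_s$ and $A_\infty=\lim_{t\to\infty}A_t$. The expectations may be infinite. *)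

theory Defs
  imports "HOL-Probability.Probability"
begin

text \<open>Time is \<open>[0,\<infinity>)\<close>, represented by the nonnegative elements of \<^typ>\<open>real\<close>; values of
  filtrations and processes at negative times are never used. Random times take values in
  \<open>[0,\<infinity>]\<close>, represented by \<^typ>\<open>ennreal\<close>.\<close>

locale usual_conditions = prob_space M for M :: "'a measure" +
  fixes F :: "real \<Rightarrow> 'a measure"
  assumes subalgebra_F: "\<And>t. 0 \<le> t \<Longrightarrow> subalgebra M (F t)"
    and F_mono: "\<And>s t. 0 \<le> s \<Longrightarrow> s \<le> t \<Longrightarrow> sets (F s) \<subseteq> sets (F t)"
    and F_right_continuous: "\<And>t. 0 \<le> t \<Longrightarrow> sets (F t) = (\<Inter>u\<in>{t<..}. sets (F u))"
    and complete: "complete_measure M"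
    and null_sets_F: "null_sets M \<subseteq> sets (F 0)"

definition adapted :: "(real \<Rightarrow> 'a measure) \<Rightarrow> (real \<Rightarrow> 'a \<Rightarrow> real) \<Rightarrow> bool" where
  "adapted F X \<longleftrightarrow> (\<forall>t\<ge>0. X t \<in> borel_measurable (F t))"

definition martingale :: "'a measure \<Rightarrow> (real \<Rightarrow> 'a measure) \<Rightarrow> (real \<Rightarrow> 'a \<Rightarrow> real) \<Rightarrow> bool" where
  "martingale M F X \<longleftrightarrow> adapted F X \<and> (\<forall>t\<ge>0. integrable M (X t)) \<and>
     (\<forall>s t. 0 \<le> s \<and> s \<le> t \<longrightarrow> (AE \<omega> in M. real_cond_exp M (F s) (X t) \<omega> = X s \<omega>))"

definition submartingale :: "'a measure \<Rightarrow> (real \<Rightarrow> 'a measure) \<Rightarrow> (real \<Rightarrow> 'a \<Rightarrow> real) \<Rightarrow> bool" where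
  "submartingale M F X \<longleftrightarrow> adapted F X \<and> (\<forall>t\<ge>0. integrable M (X t)) \<and>
     (\<forall>s t. 0 \<le> s \<and> s \<le> t \<longrightarrow> (AE \<omega> in M. X s \<omega> \<le> real_cond_exp M (F s) (X t) \<omega>))"

text \<open>The library's \<^const>\<open>stopping_time\<close> takes values in the index type of the filtration, so it
  covers neither the index set \<open>[0,\<infinity>)\<close> nor the value \<open>\<infinity>\<close>.\<close>

definition extended_stopping_time :: "(real \<Rightarrow> 'a measure) \<Rightarrow> ('a \<Rightarrow> ennreal) \<Rightarrow> bool" where
  "extended_stopping_time F T \<longleftrightarrow> (\<forall>t\<ge>0. Measurable.pred (F t) (\<lambda>\<omega>. T \<omega> \<le> ennreal t))"

definition stopped :: "(real \<Rightarrow> 'a \<Rightarrow> real) \<Rightarrow> ('a \<Rightarrow> ennreal) \<Rightarrow> real \<Rightarrow> 'a \<Rightarrow> real" where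
  "stopped X T t \<omega> = X (enn2real (min (ennreal t) (T \<omega>))) \<omega>"

text \<open>\<open>X\<close> is locally in the class \<open>C\<close> if there are stopping times \<open>T\<^sub>n \<up> \<infinity>\<close> a.s. such that every
  stopped process on \<open>{T\<^sub>n > 0}\<close> is in \<open>C\<close>. The restriction to \<open>{T\<^sub>n > 0}\<close> is the usual way not to
  require \<open>X\<^sub>0\<close> to be integrable; it is immaterial when \<open>X\<^sub>0 = 0\<close>.\<close>

definition locally_in ::
  "'a measure \<Rightarrow> (real \<Rightarrow> 'a measure) \<Rightarrow> ((real \<Rightarrow> 'a \<Rightarrow> real) \<Rightarrow> bool) \<Rightarrow> (real \<Rightarrow> 'a \<Rightarrow> real) \<Rightarrow> bool"
where
  "locally_in M F C X \<longleftrightarrow>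
     (\<exists>T :: nat \<Rightarrow> 'a \<Rightarrow> ennreal.
        (\<forall>n. extended_stopping_time F (T n)) \<and>
        (AE \<omega> in M. incseq (\<lambda>n. T n \<omega>) \<and> (\<lambda>n. T n \<omega>) \<longlonglongrightarrow> \<infinity>) \<and>
        (\<forall>n. C (\<lambda>t \<omega>. if T n \<omega> > 0 then stopped X (T n) t \<omega> else 0)))"

definition local_martingale :: "'a measure \<Rightarrow> (real \<Rightarrow> 'a measure) \<Rightarrow> (real \<Rightarrow> 'a \<Rightarrow> real) \<Rightarrow> bool" where
  "local_martingale M F X \<longleftrightarrow> adapted F X \<and> locally_in M F (martingale M F) X"

definition local_submartingale :: "'a measure \<Rightarrow> (real \<Rightarrow> 'a measure) \<Rightarrow> (real \<Rightarrow> 'a \<Rightarrow> real) \<Rightarrow> bool" where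
  "local_submartingale M F X \<longleftrightarrow> adapted F X \<and> locally_in M F (submartingale M F) X"

definition cadlag :: "(real \<Rightarrow> real) \<Rightarrow> bool" where
  "cadlag f \<longleftrightarrow> (\<forall>t\<ge>0. (f \<longlongrightarrow> f t) (at_right t)) \<and> (\<forall>t>0. \<exists>l. (f \<longlongrightarrow> l) (at_left t))"

definition only_negative_jumps :: "(real \<Rightarrow> real) \<Rightarrow> bool" where
  "only_negative_jumps f \<longleftrightarrow> (\<forall>t>0. f t - Lim (at_left t) f \<le> 0)"

text \<open>A cadlag path is bounded on compact intervals, so this supremum of reals is the true one.\<close>

definition running_sup :: "(real \<Rightarrow> 'a \<Rightarrow> real) \<Rightarrow> real \<Rightarrow> 'a \<Rightarrow> real" where
  "running_sup X t \<omega> = (SUP s\<in>{0..t}. X s \<omega>)"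

text \<open>The next two are used for nonnegative processes only; they may take the value \<open>\<infinity>\<close>.\<close>

definition total_sup :: "(real \<Rightarrow> 'a \<Rightarrow> real) \<Rightarrow> 'a \<Rightarrow> ennreal" where
  "total_sup X \<omega> = (SUP s\<in>{0..}. ennreal (X s \<omega>))"

definition limit_at_infinity :: "(real \<Rightarrow> 'a \<Rightarrow> real) \<Rightarrow> 'a \<Rightarrow> ennreal" where
  "limit_at_infinity A \<omega> = Lim at_top (\<lambda>t. ennreal (A t \<omega>))"

text \<open>The power \<open>x\<^sup>k\<close> for \<open>x \<in> [0,\<infinity>]\<close> and \<open>k > 0\<close>, with \<open>\<infinity>\<^sup>k = \<infinity>\<close>.\<close>

definition ennreal_powr :: "ennreal \<Rightarrow> real \<Rightarrow> ennreal" where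
  "ennreal_powr x k = (if x = \<infinity> then \<infinity> else ennreal (enn2real x powr k))"

end

theory Submission
  imports Defs
begin

text \<open>Both inequalities are instances of Lenglart's domination inequality. If \<open>L\<close> is a local
  martingale with \<open>L\<^sub>0 = 0\<close> and \<open>L \<ge> U - V\<close> with \<open>U \<ge> 0\<close> and \<open>V\<close> continuous and increasing from \<open>0\<close>, then
  stopping when \<open>U\<close> exceeds \<open>x\<close> or \<open>V\<close> reaches \<open>x\<close> gives
  \<open>x P(sup U > x, V\<^sub>\<infinity> < x) \<le> E[min V\<^sub>\<infinity> x]\<close>, hence \<open>P(sup U > x) \<le> P(V\<^sub>\<infinity> \<ge> x) + E[min V\<^sub>\<infinity> x] / x\<close>.
  Integrating against \<open>k x\<^bsup>k-1\<^esup> dx\<close> yields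
  \<open>E[(sup U)\<^sup>k] \<le> (1 + 1/(1-k)) E[V\<^sub>\<infinity>\<^sup>k]\<close>. The first bound is the case \<open>L = N\<close>, \<open>U = X\<close>, \<open>V = A\<close>; the
  second one is the case \<open>L = -N\<close>, \<open>U = A\<close>, \<open>V = X\<^sup>*\<close>, because \<open>-N = A - X \<ge> A - X\<^sup>*\<close>.\<close>

section \<open>Domination inequality for tails\<close>

text \<open>The grid argument uses the martingale property only in this integrated form, over events
  known at the earlier time.\<close>

lemma (in prob_space) martingale_set_integral_eq:
  assumes "subalgebra M (F s)" "martingale M F L" "0 \<le> s" "s \<le> t" "C \<in> sets (F s)"
  shows "(\<integral>\<omega>\<in>C. L s \<omega> \<partial>M) = (\<integral>\<omega>\<in>C. L t \<omega> \<partial>M)"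
proof -
  interpret finite_measure_subalgebra M "F s"
    by unfold_locales (fact assms(1))
  have C: "C \<in> sets M"
    using assms(1,5) by (auto simp: subalgebra_def)
  have "integrable M (L s)" "integrable M (L t)"
    using assms by (auto simp: martingale_def)
  have "(\<integral>\<omega>\<in>C. L t \<omega> \<partial>M) = (\<integral>\<omega>\<in>C. real_cond_exp M (F s) (L t) \<omega> \<partial>M)"
    using \<open>integrable M (L t)\<close> assms(5) by (rule real_cond_exp_intA)
  also have "\<dots> = (\<integral>\<omega>\<in>C. L s \<omega> \<partial>M)"
  proof (rule set_lebesgue_integral_cong_AE)
    show "L s \<in> borel_measurable M"
      using \<open>integrable M (L s)\<close> by simp
    show "AE \<omega>\<in>C in M. real_cond_exp M (F s) (L t) \<omega> = L s \<omega>"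
    proof -
      have "AE \<omega> in M. real_cond_exp M (F s) (L t) \<omega> = L s \<omega>"
        using assms(2-4) by (auto simp: martingale_def)
      then show ?thesis
        by eventually_elim simp
    qed
  qed (use C in auto)
  finally show ?thesis by simp
qed

context usual_conditions
begin

lemma adapted_borel_measurable: "adapted F X \<Longrightarrow> 0 \<le> t \<Longrightarrow> X t \<in> borel_measurable M"
  using measurable_from_subalg[OF subalgebra_F] by (auto simp: adapted_def)

lemma adapted_borel_measurable_mono:
  assumes "adapted F X" "0 \<le> s" "s \<le> t"
  shows "X s \<in> borel_measurable (F t)"
proof (rule measurable_from_subalg)
  show "subalgebra (F t) (F s)"
    using F_mono[OF assms(2,3)] subalgebra_F[of s] subalgebra_F[of t] assms
    by (auto simp: subalgebra_def)
  show "X s \<in> borel_measurable (F s)"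
    using assms by (auto simp: adapted_def)
qed

lemma sets_F_imp_sets: "0 \<le> t \<Longrightarrow> C \<in> sets (F t) \<Longrightarrow> C \<in> sets M"
  using subalgebra_F by (auto simp: subalgebra_def)

lemma space_F: "0 \<le> t \<Longrightarrow> space (F t) = space M"
  using subalgebra_F by (auto simp: subalgebra_def)

text \<open>Stop at the first grid point \<open>\<tau>\<close> where \<open>U > x\<close> or \<open>V \<ge> y\<close>. Grid stopping may overshoot the
  level \<open>y\<close>, and \<open>V\<close> is not known to be integrable. Since \<open>{V\<^sub>\<tau> > c}\<close> is known at time \<open>\<tau>\<close>, however,
  the martingale property turns the contribution of this event into an integral of the fixed
  integrable variable \<open>L\<close> at the final grid point over an event that vanishes as the grid is refined.\<close>

lemma martingale_domination_grid:
  fixes K :: nat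
  assumes L: "martingale M F L" and L0: "AE \<omega> in M. L 0 \<omega> = 0"
    and U: "adapted F U" and V: "adapted F V"
    and U_nonneg: "AE \<omega> in M. \<forall>t\<ge>0. 0 \<le> U t \<omega>"
    and dom: "AE \<omega> in M. \<forall>t\<ge>0. U t \<omega> - V t \<omega> \<le> L t \<omega>"
    and V_mono: "AE \<omega> in M. mono_on {0..} (\<lambda>t. V t \<omega>)"
    and V0: "AE \<omega> in M. V 0 \<omega> = 0"
    and p0: "p 0 = 0" and p_mono: "mono p" and xyc: "0 < x" "0 < y" "y \<le> c"
  shows "x * prob {\<omega>\<in>space M. (\<exists>i\<le>K. x < U (p i) \<omega>) \<and> V (p K) \<omega> < y}
    \<le> (\<integral>\<omega>. indicator {\<omega>\<in>space M. \<exists>i<K. V (p i) \<omega> < y \<and> c < V (p (Suc i)) \<omega>} \<omega> * \<bar>L (p K) \<omega>\<bar> \<partial>M)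
      + (\<integral>\<omega>. min (V (p K) \<omega>) c \<partial>M)"
proof -
  \<comment> \<open>The alternative \<open>i = K\<close> makes the search succeed, so
    \<open>\<tau>\<close> never exceeds the last index.\<close>
  define \<tau> where "\<tau> \<omega> = (LEAST i. i = K \<or> x < U (p i) \<omega> \<or> y \<le> V (p i) \<omega>)" for \<omega>
  define G where "G i = {\<omega>\<in>space M. \<tau> \<omega> = i \<and> V (p i) \<omega> \<le> c}" for i
  define E where "E = {\<omega>\<in>space M. (\<exists>i\<le>K. x < U (p i) \<omega>) \<and> V (p K) \<omega> < y}"
  define B where "B = {\<omega>\<in>space M. \<exists>i<K. V (p i) \<omega> < y \<and> c < V (p (Suc i)) \<omega>}"
  \<comment> \<open>The \<open>G i\<close> are disjoint, so on \<open>space M\<close> this is the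
    indicator of the event that V is at most \<open>c\<close> at the stopping point.\<close>
  define b where "b = (\<lambda>\<omega>. (\<Sum>i\<le>K. indicator (G i) \<omega>) :: real)"
  have p_nonneg [simp]: "0 \<le> p i" for i
    using monoD[OF p_mono, of 0 i] p0 by simp
  have p_le: "i \<le> j \<Longrightarrow> p i \<le> p j" for i j
    using monoD[OF p_mono] .
  have UV_F: "U (p j) \<in> borel_measurable (F (p i))" "V (p j) \<in> borel_measurable (F (p i))" if "j \<le> i" for i j
    using adapted_borel_measurable_mono U V p_le[OF that] by auto
  have \<tau>_eq_iff: "\<tau> \<omega> = i \<longleftrightarrow> (i = K \<or> x < U (p i) \<omega> \<or> y \<le> V (p i) \<omega>) \<and>
    (\<forall>j<i. j \<noteq> K \<and> U (p j) \<omega> \<le> x \<and> V (p j) \<omega> < y)" for \<omega> i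
  proof -
    let ?P = "\<lambda>i. i = K \<or> x < U (p i) \<omega> \<or> y \<le> V (p i) \<omega>"
    have "?P (\<tau> \<omega>)"
      unfolding \<tau>_def by (rule LeastI[of ?P K]) simp
    moreover have "\<not> ?P j" if "j < \<tau> \<omega>" for j
      using that unfolding \<tau>_def by (rule not_less_Least)
    ultimately show ?thesis
      by (metis linorder_neqE_nat not_le)
  qed
  have \<tau>_le: "\<tau> \<omega> \<le> K" for \<omega>
    unfolding \<tau>_def by (rule Least_le) simp
  have G_F: "G i \<in> sets (F (p i))" for i
  proof -
    have "G i = {\<omega>\<in>space (F (p i)). ((i = K \<or> x < U (p i) \<omega> \<or> y \<le> V (p i) \<omega>) \<and>
      (\<forall>j\<in>{..<i}. j \<noteq> K \<and> U (p j) \<omega> \<le> x \<and> V (p j) \<omega> < y)) \<and> V (p i) \<omega> \<le> c}"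
      unfolding G_def \<tau>_eq_iff space_F[OF p_nonneg] by auto
    also have "\<dots> \<in> sets (F (p i))"
      using UV_F[of _ i]
      by (intro sets.sets_Collect_conj sets.sets_Collect_disj sets.sets_Collect_finite_All
        sets.sets_Collect_const borel_measurable_le borel_measurable_less borel_measurable_const) auto
    finally show ?thesis .
  qed
  note [measurable] = adapted_borel_measurable[OF U p_nonneg] adapted_borel_measurable[OF V p_nonneg]
  have int_L: "integrable M (L (p i))" for i
    using L by (auto simp: martingale_def)
  note [measurable] = borel_measurable_integrable[OF int_L]
  have [measurable]: "G i \<in> sets M" for i
    using sets_F_imp_sets[OF _ G_F] by simp
  have [measurable]: "E \<in> sets M" "B \<in> sets M"
    unfolding E_def B_def by measurable
  have sum_G: "(\<Sum>i\<le>K. indicator (G i) \<omega> * f i) = (if V (p (\<tau> \<omega>)) \<omega> \<le> c then f (\<tau> \<omega>) else 0)"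
    if "\<omega> \<in> space M" for \<omega> and f :: "nat \<Rightarrow> real"
  proof -
    have "(\<Sum>i\<le>K. indicator (G i) \<omega> * f i) = (\<Sum>i\<le>K. if i = \<tau> \<omega> then (if V (p (\<tau> \<omega>)) \<omega> \<le> c then f (\<tau> \<omega>) else 0) else 0)"
      using that by (intro sum.cong) (auto simp: G_def split: split_indicator)
    also have "\<dots> = (if V (p (\<tau> \<omega>)) \<omega> \<le> c then f (\<tau> \<omega>) else 0)"
      using \<tau>_le[of \<omega>] by (subst sum.delta) auto
    finally show ?thesis .
  qed
  have [measurable]: "b \<in> borel_measurable M"
    unfolding b_def by measurable
  have int_GL: "integrable M (\<lambda>\<omega>. indicator (G i) \<omega> * L (p j) \<omega>)" for i j
    using integrable_mult_indicator[OF _ int_L[of j], of "G i"] by (simp)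
  have bdd_V: "AE \<omega> in M. 0 \<le> V (p K) \<omega>"
    using V_mono V0 by eventually_elim (auto dest!: mono_onD[of _ _ 0 "p K"])
  have int_min: "integrable M (\<lambda>\<omega>. min (V (p K) \<omega>) c)"
    by (rule integrable_const_bound[of _ c]) (use bdd_V xyc in \<open>auto simp: min_def\<close>)
  have int_BL: "integrable M (\<lambda>\<omega>. indicator B \<omega> * \<bar>L (p K) \<omega>\<bar>)"
    using integrable_mult_indicator[OF \<open>B \<in> sets M\<close> integrable_abs[OF int_L[of K]]] by simp
  have "x * prob E = (\<integral>\<omega>. x * indicator E \<omega> \<partial>M)"
    by simp
  \<comment> \<open>Pointwise bound. On \<open>E\<close> stopping is caused by U > x, so x <
    L_\<tau> + V_\<tau>, and V_\<tau> is at most the final value of V, which lies below y \<le> c.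
    Off \<open>E\<close> either V_\<tau> > c and the sum is 0, or L_\<tau> \<ge> -V_\<tau>, where
    V_\<tau> is bounded both by \<open>c\<close> and by the final value of V.\<close>
  also have "\<dots> \<le> (\<integral>\<omega>. (\<Sum>i\<le>K. indicator (G i) \<omega> * L (p i) \<omega>) + min (V (p K) \<omega>) c \<partial>M)"
  proof (rule integral_mono_AE)
    show "AE \<omega> in M. x * indicator E \<omega> \<le> (\<Sum>i\<le>K. indicator (G i) \<omega> * L (p i) \<omega>) + min (V (p K) \<omega>) c"
      using U_nonneg dom V_mono V0 bdd_V AE_space
    proof eventually_elim
      case (elim \<omega>)
      have V_le: "V (p i) \<omega> \<le> V (p j) \<omega>" if "i \<le> j" for i j
        using mono_onD[OF elim(3), of "p i" "p j"] p_le[OF that] by simp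
      have dom\<tau>: "U (p (\<tau> \<omega>)) \<omega> - V (p (\<tau> \<omega>)) \<omega> \<le> L (p (\<tau> \<omega>)) \<omega>" "0 \<le> U (p (\<tau> \<omega>)) \<omega>"
        using elim by auto
      have V_bound: "V (p (\<tau> \<omega>)) \<omega> \<le> V (p K) \<omega>"
        using V_le \<tau>_le by simp
      show ?case
      proof (cases "\<omega> \<in> E")
        case False
        then show ?thesis
          using dom\<tau> V_bound elim(5) xyc unfolding sum_G[OF elim(6)] by (auto simp: min_def)
      next
        case True
        then obtain i where i: "i \<le> K" "x < U (p i) \<omega>" and VK: "V (p K) \<omega> < y"
          by (auto simp: E_def)
        have V_lt: "V (p j) \<omega> < y" if "j \<le> K" for j
          using V_le[OF that] VK by simp
        \<comment> \<open>On \<open>E\<close> the level \<open>y\<close> is not reached on the grid.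
          If U did not exceed \<open>x\<close> at \<open>\<tau>\<close>, stopping would happen by
          default at \<open>K\<close> with U \<le> x at all grid points, against the choice of
          \<open>i\<close>.\<close>
        have "x < U (p (\<tau> \<omega>)) \<omega>"
        proof (rule ccontr)
          assume "\<not> x < U (p (\<tau> \<omega>)) \<omega>"
          then have "\<tau> \<omega> = K"
            using \<tau>_eq_iff[of \<omega> "\<tau> \<omega>"] V_lt[of "\<tau> \<omega>"] \<tau>_le by auto
          then show False
            using i \<tau>_eq_iff[of \<omega> K] \<open>\<not> x < U (p (\<tau> \<omega>)) \<omega>\<close> le_neq_implies_less[of i K]
            by (metis not_less)
        qed
        then show ?thesis
          using True dom\<tau> V_bound elim(5) xyc V_lt[OF \<tau>_le] VK unfolding sum_G[OF elim(6)]
          by (auto simp: min_def)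
      qed
    qed
  next
    have "integrable M (indicator E :: 'a \<Rightarrow> real)"
      by (rule integrable_real_indicator) (auto simp: emeasure_eq_measure)
    then show "integrable M (\<lambda>\<omega>. x * indicator E \<omega>)"
      by simp
    show "integrable M (\<lambda>\<omega>. (\<Sum>i\<le>K. indicator (G i) \<omega> * L (p i) \<omega>) + min (V (p K) \<omega>) c)"
      by (intro Bochner_Integration.integrable_add Bochner_Integration.integrable_sum int_GL int_min)
  qed
  also have "\<dots> = (\<Sum>i\<le>K. \<integral>\<omega>. indicator (G i) \<omega> * L (p i) \<omega> \<partial>M) + (\<integral>\<omega>. min (V (p K) \<omega>) c \<partial>M)"
    by (subst Bochner_Integration.integral_add)
      (intro arg_cong2[where f="(+)"] refl Bochner_Integration.integral_sum Bochner_Integration.integrable_sum int_GL int_min)+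
  \<comment> \<open>Optional stopping by hand: \<open>G i\<close> is known at time
    \<open>p i\<close>, so on it L may be replaced by its value at the final grid point.\<close>
  also have "(\<Sum>i\<le>K. \<integral>\<omega>. indicator (G i) \<omega> * L (p i) \<omega> \<partial>M)
      = (\<Sum>i\<le>K. \<integral>\<omega>. indicator (G i) \<omega> * L (p K) \<omega> \<partial>M)"
  proof (rule sum.cong)
    fix i assume "i \<in> {..K}"
    then show "(\<integral>\<omega>. indicator (G i) \<omega> * L (p i) \<omega> \<partial>M) = (\<integral>\<omega>. indicator (G i) \<omega> * L (p K) \<omega> \<partial>M)"
      using martingale_set_integral_eq[OF subalgebra_F[of "p i"] L _ p_le[of i K] G_F]
      by (simp add: set_lebesgue_integral_def)
  qed simp
  also have "\<dots> = (\<integral>\<omega>. b \<omega> * L (p K) \<omega> \<partial>M)"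
    unfolding b_def sum_distrib_right
    by (rule Bochner_Integration.integral_sum[symmetric]) (rule int_GL)
  also have "\<dots> \<le> (\<integral>\<omega>. L (p K) \<omega> + indicator B \<omega> * \<bar>L (p K) \<omega>\<bar> \<partial>M)"
  proof (rule integral_mono_AE)
    show "integrable M (\<lambda>\<omega>. b \<omega> * L (p K) \<omega>)"
      unfolding b_def sum_distrib_right
      by (rule Bochner_Integration.integrable_sum) (rule int_GL)
    show "AE \<omega> in M. b \<omega> * L (p K) \<omega> \<le> L (p K) \<omega> + indicator B \<omega> * \<bar>L (p K) \<omega>\<bar>"
      using V0 AE_space
    proof eventually_elim
      case (elim \<omega>)
      have b: "b \<omega> = (if V (p (\<tau> \<omega>)) \<omega> \<le> c then 1 else 0)"
        using sum_G[of \<omega> "\<lambda>_. 1"] elim by (simp add: b_def)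
      show ?case
      proof (cases "V (p (\<tau> \<omega>)) \<omega> \<le> c")
        case False
        \<comment> \<open>V starts from 0 and cannot exceed \<open>c\<close> at index 0. At the
          predecessor of \<open>\<tau>\<close> stopping had not yet happened, so V was below
          \<open>y\<close> there: one grid step leads from below \<open>y\<close> to above
          \<open>c\<close>, which is the event \<open>B\<close>.\<close>
        then have "\<tau> \<omega> \<noteq> 0"
          using elim xyc p0 by (metis dual_order.trans less_le_not_le)
        then obtain j where j: "\<tau> \<omega> = Suc j"
          using not0_implies_Suc by blast
        then have "V (p j) \<omega> < y" "j < K"
          using \<tau>_eq_iff[of \<omega> "\<tau> \<omega>"] \<tau>_le[of \<omega>] by auto
        then have "\<omega> \<in> B"
          using False j elim by (auto simp: B_def)
        then show ?thesis
          using b False by simp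
      qed (use b in simp)
    qed
  qed (use int_L int_BL in auto)
  also have "\<dots> = (\<integral>\<omega>. indicator B \<omega> * \<bar>L (p K) \<omega>\<bar> \<partial>M)"
  proof -
    have "(\<integral>\<omega>. L (p K) \<omega> \<partial>M) = (\<integral>\<omega>. L 0 \<omega> \<partial>M)"
      using martingale_set_integral_eq[OF subalgebra_F[of 0] L, of "p K" "space M"]
        sets.top[of "F 0"] space_F[of 0] p0 int_L[of 0] int_L[of K]
      by (simp add: set_integral_space)
    also have "\<dots> = 0"
      using L0 by (simp add: integral_eq_zero_AE)
    finally show ?thesis
      using int_L int_BL by simp
  qed
  finally show ?thesis
    unfolding E_def B_def by simp
qed

text \<open>The grid bound is used on dyadic meshes with a level \<open>c\<close> strictly above
  \<open>y\<close>. Uniform continuity of V on [0, n] excludes, for fine meshes, a rise from below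
  \<open>y\<close> to above \<open>c\<close> in one step, so the error integrals vanish by dominated
  convergence with majorant |L_n|. Finally \<open>c\<close> decreases to \<open>y\<close>.\<close>

lemma martingale_domination:
  fixes n :: nat
  assumes L: "martingale M F L" and L0: "AE \<omega> in M. L 0 \<omega> = 0"
    and U: "adapted F U" and V: "adapted F V"
    and U_nonneg: "AE \<omega> in M. \<forall>t\<ge>0. 0 \<le> U t \<omega>"
    and dom: "AE \<omega> in M. \<forall>t\<ge>0. U t \<omega> - V t \<omega> \<le> L t \<omega>"
    and V_cont: "AE \<omega> in M. continuous_on {0..} (\<lambda>t. V t \<omega>)"
    and V_mono: "AE \<omega> in M. mono_on {0..} (\<lambda>t. V t \<omega>)"
    and V0: "AE \<omega> in M. V 0 \<omega> = 0"
    and xy: "0 < x" "0 < y"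
  shows "x * prob {\<omega>\<in>space M. (\<exists>m. \<exists>i\<le>n * 2^m. x < U (real i / 2^m) \<omega>) \<and> V n \<omega> < y}
    \<le> (\<integral>\<omega>. min (V n \<omega>) y \<partial>M)"
proof -
  define E where "E m = {\<omega>\<in>space M. (\<exists>i\<le>n * 2^m. x < U (real i / 2^m) \<omega>) \<and> V n \<omega> < y}" for m :: nat
  define B where "B c m = {\<omega>\<in>space M. \<exists>i<n * 2^m. V (real i / 2^m) \<omega> < y \<and> c < V (real (Suc i) / 2^m) \<omega>}"
    for c and m :: nat
  define J where "J c m = (\<integral>\<omega>. indicator (B c m) \<omega> * \<bar>L n \<omega>\<bar> \<partial>M)" for c m
  define I where "I c = (\<integral>\<omega>. min (V n \<omega>) c \<partial>M)" for c
  have int_L: "integrable M (L (real n))"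
    using L by (auto simp: martingale_def)
  note [measurable] = borel_measurable_integrable[OF int_L]
  have [measurable]: "U (real i / 2^m) \<in> borel_measurable M" "V (real i / 2^m) \<in> borel_measurable M"
    "V (real n) \<in> borel_measurable M" for i m
    using adapted_borel_measurable U V by auto
  have [measurable]: "E m \<in> sets M" "B c m \<in> sets M" for m c
    unfolding E_def B_def by measurable
  have bdd_V: "AE \<omega> in M. 0 \<le> V n \<omega>"
    using V_mono V0 by eventually_elim (auto dest!: mono_onD[of _ _ 0 "real n"])
  have int_min: "integrable M (\<lambda>\<omega>. min (V n \<omega>) c)" if "0 < c" for c
    by (rule integrable_const_bound[of _ c]) (use bdd_V that in \<open>auto simp: min_def\<close>)
  have grid: "x * prob (E m) \<le> J c m + I c" if "y < c" for m c
  proof -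
    have "mono (\<lambda>i. real i / 2^m)"
      by (auto intro!: monoI divide_right_mono)
    from martingale_domination_grid[OF L L0 U V U_nonneg dom V_mono V0 _ this xy, of c "n * 2^m"]
    show ?thesis
      using that by (simp add: E_def B_def J_def I_def)
  qed
  have J_lim: "J c \<longlonglongrightarrow> 0" if "y < c" for c
  proof -
    have "(\<lambda>m. \<integral>\<omega>. indicator (B c m) \<omega> * \<bar>L n \<omega>\<bar> \<partial>M) \<longlonglongrightarrow> (\<integral>\<omega>. 0 \<partial>M)"
    proof (rule integral_dominated_convergence)
      show "integrable M (\<lambda>\<omega>. \<bar>L n \<omega>\<bar>)"
        using int_L by simp
      show "AE \<omega> in M. norm (indicator (B c m) \<omega> * \<bar>L n \<omega>\<bar>) \<le> \<bar>L n \<omega>\<bar>" for m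
        by (auto split: split_indicator)
      show "AE \<omega> in M. (\<lambda>m. indicator (B c m) \<omega> * \<bar>L n \<omega>\<bar>) \<longlonglongrightarrow> 0"
        using V_cont
      proof eventually_elim
        case (elim \<omega>)
        have "uniformly_continuous_on {0..real n} (\<lambda>t. V t \<omega>)"
          by (rule compact_uniformly_continuous) (auto intro: continuous_on_subset[OF elim])
        then obtain d where d: "d > 0"
          "\<And>s t. s \<in> {0..real n} \<Longrightarrow> t \<in> {0..real n} \<Longrightarrow> dist t s < d \<Longrightarrow> dist (V t \<omega>) (V s \<omega>) < c - y"
          using \<open>y < c\<close> unfolding uniformly_continuous_on_def by (metis diff_gt_0_iff_gt)
        have "(\<lambda>m. (1/2::real)^m) \<longlonglongrightarrow> 0"
          by (rule LIMSEQ_realpow_zero) auto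
        then have "\<forall>\<^sub>F m in sequentially. (1/2::real)^m < d"
          using d(1) by (rule order_tendstoD)
        then have "\<forall>\<^sub>F m in sequentially. indicator (B c m) \<omega> * \<bar>L n \<omega>\<bar> = 0"
        proof eventually_elim
          case (elim m)
          have "\<omega> \<notin> B c m"
          proof
            assume "\<omega> \<in> B c m"
            then obtain i where i: "i < n * 2^m" "V (real i / 2^m) \<omega> < y" "c < V (real (Suc i) / 2^m) \<omega>"
              by (auto simp: B_def)
            have "real (Suc i) \<le> real (n * 2^m)" "real i \<le> real (n * 2^m)"
              using i(1) by (simp_all only: of_nat_le_iff)
            then have "real (Suc i) / 2^m \<le> n" "real i / 2^m \<le> n"
              by (simp_all add: field_simps)
            then have "dist (V (real (Suc i) / 2^m) \<omega>) (V (real i / 2^m) \<omega>) < c - y"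
              using elim by (intro d(2)) (auto simp: dist_real_def field_simps power_divide)
            then show False
              using i by (auto simp: dist_real_def)
          qed
          then show ?case by simp
        qed
        then show ?case
          by (rule tendsto_eventually)
      qed
    qed auto
    then show ?thesis
      by (simp add: J_def[abs_def])
  qed
  have "incseq E"
  proof (rule incseq_SucI, rule subsetI)
    fix m \<omega> assume "\<omega> \<in> E m"
    then obtain i where "i \<le> n * 2^m" "x < U (real i / 2^m) \<omega>" "V n \<omega> < y" "\<omega> \<in> space M"
      by (auto simp: E_def)
    \<comment> \<open>The dyadic point i/2^m reappears on the next grid as 2i/2^(m+1).\<close>
    then show "\<omega> \<in> E (Suc m)"
      by (auto simp: E_def intro!: exI[of _ "2 * i"])
  qed
  have "(\<lambda>m. prob (E m)) \<longlonglongrightarrow> prob (\<Union>m. E m)"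
    by (rule finite_Lim_measure_incseq) (use \<open>incseq E\<close> in auto)
  then have E_lim: "(\<lambda>m. x * prob (E m)) \<longlonglongrightarrow> x * prob (\<Union>m. E m)"
    by (rule tendsto_mult_left)
  \<comment> \<open>The level is c = y + e; truncating V at y + e instead of \<open>y\<close> raises
    the mean by at most \<open>e\<close>.\<close>
  have "x * prob (\<Union>m. E m) \<le> I y + e" if "0 < e" for e
  proof -
    have "x * prob (\<Union>m. E m) \<le> 0 + I (y + e)"
    proof (rule LIMSEQ_le[OF E_lim])
      show "(\<lambda>m. J (y + e) m + I (y + e)) \<longlonglongrightarrow> 0 + I (y + e)"
        using that by (intro tendsto_add J_lim tendsto_const) auto
    qed (use grid that in auto)
    also have "\<dots> \<le> (\<integral>\<omega>. min (V n \<omega>) y + e \<partial>M)"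
      unfolding I_def add_0_left using that xy
      by (intro integral_mono int_min Bochner_Integration.integrable_add) auto
    also have "\<dots> = I y + e"
      using int_min[OF xy(2)] by (simp add: I_def prob_space)
    finally show ?thesis .
  qed
  then have "x * prob (\<Union>m. E m) \<le> I y"
    by (rule field_le_epsilon)
  moreover have "(\<Union>m. E m) = {\<omega>\<in>space M. (\<exists>m. \<exists>i\<le>n * 2^m. x < U (real i / 2^m) \<omega>) \<and> V n \<omega> < y}"
    by (auto simp: E_def)
  ultimately show ?thesis
    by (simp add: I_def)
qed

text \<open>Localization: the preceding bound is applied to each stopped martingale and a killed
  version of U. Almost surely \<open>T k\<close> eventually exceeds \<open>n\<close>, so the killing
  disappears from [0, n] as \<open>k\<close> grows, while the right-hand side does not depend on
  \<open>k\<close>.\<close>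

lemma local_martingale_domination:
  fixes n :: nat
  assumes L: "local_martingale M F L" and L0: "AE \<omega> in M. L 0 \<omega> = 0"
    and U: "adapted F U" and V: "adapted F V"
    and U_nonneg: "AE \<omega> in M. \<forall>t\<ge>0. 0 \<le> U t \<omega>"
    and dom: "AE \<omega> in M. \<forall>t\<ge>0. U t \<omega> - V t \<omega> \<le> L t \<omega>"
    and V_cont: "AE \<omega> in M. continuous_on {0..} (\<lambda>t. V t \<omega>)"
    and V_mono: "AE \<omega> in M. mono_on {0..} (\<lambda>t. V t \<omega>)"
    and V0: "AE \<omega> in M. V 0 \<omega> = 0"
    and xy: "0 < x" "0 < y"
  shows "x * prob {\<omega>\<in>space M. (\<exists>m. \<exists>i\<le>n * 2^m. x < U (real i / 2^m) \<omega>) \<and> V n \<omega> < y}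
    \<le> (\<integral>\<omega>. min (V n \<omega>) y \<partial>M)"
proof -
  obtain T :: "nat \<Rightarrow> 'a \<Rightarrow> ennreal" where T: "\<And>k. extended_stopping_time F (T k)"
    and T_lim: "AE \<omega> in M. (\<lambda>k. T k \<omega>) \<longlonglongrightarrow> \<infinity>"
    and mart: "\<And>k. martingale M F (\<lambda>t \<omega>. if T k \<omega> > 0 then stopped L (T k) t \<omega> else 0)"
    using L unfolding local_martingale_def locally_in_def by auto
  \<comment> \<open>\<open>V\<close> itself need not be stopped, being increasing. Killing \<open>U\<close> at \<open>T\<^sub>k\<close>, rather than stopping it,
    keeps it adapted without any progressive measurability.\<close>
  define W where "W k t \<omega> = (if T k \<omega> \<le> ennreal t then 0 else U t \<omega>)" for k t \<omega>
  have W: "adapted F (W k)" for k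
    unfolding adapted_def
  proof safe
    fix t :: real assume t: "0 \<le> t"
    have [measurable]: "Measurable.pred (F t) (\<lambda>\<omega>. T k \<omega> \<le> ennreal t)" "U t \<in> borel_measurable (F t)"
      using T[of k] U t by (auto simp: extended_stopping_time_def adapted_def)
    show "W k t \<in> borel_measurable (F t)"
      unfolding W_def[abs_def] by measurable
  qed
  have V_nonneg: "AE \<omega> in M. \<forall>s\<ge>0. \<forall>t\<ge>s. 0 \<le> V s \<omega> \<and> V s \<omega> \<le> V t \<omega>"
    using V_mono V0
  proof eventually_elim
    case (elim \<omega>)
    show ?case
      using mono_onD[OF elim(1)] elim(2) by (metis atLeast_iff order_refl order_trans)
  qed
  define E where "E k = {\<omega>\<in>space M. (\<exists>m. \<exists>i\<le>n * 2^m. x < W k (real i / 2^m) \<omega>) \<and> V n \<omega> < y}" for k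
  define E' where "E' = {\<omega>\<in>space M. (\<exists>m. \<exists>i\<le>n * 2^m. x < U (real i / 2^m) \<omega>) \<and> V n \<omega> < y}"
  have [measurable]: "U (real i / 2^m) \<in> borel_measurable M" "W k (real i / 2^m) \<in> borel_measurable M"
    "V (real n) \<in> borel_measurable M" for i m k
    using adapted_borel_measurable U V W by auto
  have [measurable]: "E k \<in> sets M" "E' \<in> sets M" for k
    unfolding E_def E'_def by measurable
  have bound: "x * prob (E k) \<le> (\<integral>\<omega>. min (V n \<omega>) y \<partial>M)" for k
    unfolding E_def
  proof (rule martingale_domination[OF mart[of k] _ W V _ _ V_cont V_mono V0 xy])
    show "AE \<omega> in M. (if T k \<omega> > 0 then stopped L (T k) 0 \<omega> else 0) = 0"
      using L0 by eventually_elim (auto simp: stopped_def)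
    show "AE \<omega> in M. \<forall>t\<ge>0. 0 \<le> W k t \<omega>"
      using U_nonneg by eventually_elim (auto simp: W_def)
    show "AE \<omega> in M. \<forall>t\<ge>0. W k t \<omega> - V t \<omega> \<le> (if 0 < T k \<omega> then stopped L (T k) t \<omega> else 0)"
      using U_nonneg dom V_nonneg
    proof eventually_elim
      case (elim \<omega>)
      show ?case
      proof (intro allI impI)
        fix t :: real assume t: "0 \<le> t"
        show "W k t \<omega> - V t \<omega> \<le> (if 0 < T k \<omega> then stopped L (T k) t \<omega> else 0)"
        proof (cases "T k \<omega> \<le> ennreal t")
          case False
          then have "stopped L (T k) t \<omega> = L t \<omega>" "0 < T k \<omega>"
            using t by (auto simp: stopped_def min_def not_le le_less_trans[OF zero_le])
          then show ?thesis
            using False elim t by (auto simp: W_def)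
        next
          case True
          \<comment> \<open>From \<open>T k\<close> on, the killed process is 0 and the stopped
            martingale keeps its value at \<open>T k\<close>. That value is at least -V there
            because U \<ge> 0, hence at least -V_t by monotonicity.\<close>
          define s where "s = enn2real (T k \<omega>)"
          have s: "0 \<le> s" "s \<le> t"
            using True t enn2real_mono[OF True] by (auto simp: s_def)
          have "stopped L (T k) t \<omega> = L s \<omega>"
            using True by (simp add: stopped_def s_def min_def antisym)
          moreover have "- V t \<omega> \<le> L s \<omega>"
            using elim s by (smt (verit))
          ultimately show ?thesis
            using True elim t by (auto simp: W_def)
        qed
      qed
    qed
  qed
  have "(\<lambda>k. \<integral>\<omega>. indicator (E k) \<omega> \<partial>M) \<longlonglongrightarrow> (\<integral>\<omega>. indicator E' \<omega> \<partial>M :: real)"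
  proof (rule integral_dominated_convergence)
    show "AE \<omega> in M. (\<lambda>k. indicator (E k) \<omega>) \<longlonglongrightarrow> (indicator E' \<omega> :: real)"
      using T_lim
    proof eventually_elim
      case (elim \<omega>)
      have "\<forall>\<^sub>F k in sequentially. ennreal n < T k \<omega>"
        using elim by (rule order_tendstoD) simp
      then have "\<forall>\<^sub>F k in sequentially. indicator (E k) \<omega> = (indicator E' \<omega> :: real)"
      proof eventually_elim
        case (elim k)
        have W_eq: "W k (real i / 2^m) \<omega> = U (real i / 2^m) \<omega>" if "i \<le> n * 2^m" for i m
        proof -
          have "real i \<le> real (n * 2^m)"
            using that by (simp only: of_nat_le_iff)
          then have "ennreal (real i / 2^m) \<le> ennreal n"
            by (intro ennreal_leI) (simp add: field_simps)
          then have "\<not> T k \<omega> \<le> ennreal (real i / 2^m)"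
            using elim by (metis leD order_trans)
          then show ?thesis
            by (simp add: W_def)
        qed
        then have "\<omega> \<in> E k \<longleftrightarrow> \<omega> \<in> E'"
          by (simp add: E_def E'_def W_eq cong: conj_cong)
        then show ?case
          by (simp add: indicator_def)
      qed
      then show ?case
        by (rule tendsto_eventually)
    qed
    show "AE \<omega> in M. norm (indicator (E k) \<omega> :: real) \<le> 1" for k
      by (auto split: split_indicator)
  qed auto
  then have "(\<lambda>k. x * prob (E k)) \<longlonglongrightarrow> x * prob E'"
    by (intro tendsto_mult_left) simp
  then have "x * prob E' \<le> (\<integral>\<omega>. min (V n \<omega>) y \<partial>M)"
    by (rule LIMSEQ_le_const2) (use bound in auto)
  then show ?thesis
    by (simp add: E'_def)
qed

end

section \<open>From tails to moments\<close>

lemma borel_measurable_ennreal_powr [measurable]: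
  "(\<lambda>z. ennreal_powr z k) \<in> borel_measurable borel"
  unfolding ennreal_powr_def by measurable

text \<open>The weight is the derivative of x^k, as in the layer-cake formula. Since k > 0 it is
  integrable at 0, and its primitive is unbounded, which gives the value for z =
  \<infinity>.\<close>

lemma nn_integral_powr_weight_le:
  assumes "0 < k"
  shows "(\<integral>\<^sup>+x. ennreal (k * x powr (k - 1)) * indicator {0..} x * indicator {x. ennreal x \<le> z} x \<partial>lborel)
    = ennreal_powr z k"
proof -
  have finite_case: "(\<integral>\<^sup>+x. ennreal (k * x powr (k - 1)) * indicator {0..c} x \<partial>lborel) = ennreal (c powr k)"
    if "0 \<le> c" for c
  proof -
    have "((\<lambda>x. k * x powr (k - 1)) has_integral k * (c powr (k - 1 + 1) / (k - 1 + 1))) {0..c}"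
      using that \<open>0 < k\<close> by (intro has_integral_mult_right has_integral_powr_from_0) auto
    then have "((\<lambda>x. k * x powr (k - 1)) has_integral c powr k) {0..c}"
      using \<open>0 < k\<close> by simp
    from nn_integral_has_integral_lebesgue[OF _ this] show ?thesis
      using \<open>0 < k\<close> by (simp add: ennreal_mult'' ennreal_indicator mult.commute)
  qed
  show ?thesis
  proof (cases z)
    case (real c)
    then have "(\<integral>\<^sup>+x. ennreal (k * x powr (k - 1)) * indicator {0..} x * indicator {x. ennreal x \<le> z} x \<partial>lborel)
      = (\<integral>\<^sup>+x. ennreal (k * x powr (k - 1)) * indicator {0..c} x \<partial>lborel)"
      by (intro nn_integral_cong) (auto split: split_indicator)
    then show ?thesis
      using real finite_case by (simp add: ennreal_powr_def)
  next
    case top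
    have "(\<integral>\<^sup>+x. ennreal (k * x powr (k - 1)) * indicator {0..} x * indicator {x. ennreal x \<le> z} x \<partial>lborel) = \<infinity>"
      (is "?I = _")
    proof (rule ccontr)
      assume "?I \<noteq> \<infinity>"
      then obtain r where r: "?I = ennreal r" "0 \<le> r"
        by (cases ?I) auto
      \<comment> \<open>This choice makes the integral over [0, c] equal to r + 1, more than the
        supposed total \<open>r\<close>.\<close>
      define c where "c = (r + 1) powr (1 / k)"
      have "c powr k = r + 1"
        using r \<open>0 < k\<close> by (simp add: c_def powr_powr)
      then have "ennreal (r + 1) = (\<integral>\<^sup>+x. ennreal (k * x powr (k - 1)) * indicator {0..c} x \<partial>lborel)"
        by (subst finite_case) (auto simp: c_def)
      also have "\<dots> \<le> ?I"
        using top by (intro nn_integral_mono) (auto split: split_indicator)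
      finally show False
        using r by simp
    qed
    then show ?thesis
      using top by (simp add: ennreal_powr_def)
  qed
qed

text \<open>On [0, \<infinity>) the strict and the weak condition differ at most at the point
  \<open>enn2real z\<close>, which is Lebesgue null. The strict form fits the tail of the dominated
  variable, the weak form that of the dominating one.\<close>

lemma nn_integral_powr_weight_less:
  assumes "0 < k"
  shows "(\<integral>\<^sup>+x. ennreal (k * x powr (k - 1)) * indicator {0..} x * indicator {x. ennreal x < z} x \<partial>lborel)
    = ennreal_powr z k"
proof -
  have "AE x in lborel. x \<noteq> enn2real z"
    by (rule AE_lborel_singleton)
  then have "(\<integral>\<^sup>+x. ennreal (k * x powr (k - 1)) * indicator {0..} x * indicator {x. ennreal x < z} x \<partial>lborel)
    = (\<integral>\<^sup>+x. ennreal (k * x powr (k - 1)) * indicator {0..} x * indicator {x. ennreal x \<le> z} x \<partial>lborel)"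
    by (intro nn_integral_cong_AE, eventually_elim) (auto split: split_indicator simp: less_le)
  then show ?thesis
    using nn_integral_powr_weight_le[OF assms] by simp
qed

text \<open>Split at z = c. Below \<open>c\<close> the minimum is x and the integral is c^k; above
  \<open>c\<close> the minimum is \<open>c\<close> and k c x^(k-2) integrates to k/(1-k) c^k, which
  is finite because k < 1. Together these give c^k/(1-k).\<close>

lemma nn_integral_powr_weight_min:
  assumes k: "0 < k" "k < 1"
  shows "(\<integral>\<^sup>+x. ennreal (k * x powr (k - 2)) * indicator {0..} x * min z (ennreal x) \<partial>lborel)
    \<le> ennreal (1 / (1 - k)) * ennreal_powr z k"
proof (cases z)
  case top
  then show ?thesis
    using k by (simp add: ennreal_powr_def ennreal_mult_top)
next
  case (real c)
  show ?thesis
  proof (cases "c = 0")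
    case True
    then show ?thesis
      using real by (simp add: min_def)
  next
    case False
    then have c: "0 < c"
      using real by simp
    have "((\<lambda>x. k * c * x powr (k - 2)) has_integral k * c * (- (c powr (k - 2 + 1)) / (k - 2 + 1))) {c..}"
      using k c by (intro has_integral_mult_right has_integral_powr_to_inf) auto
    from nn_integral_has_integral_lebesgue[OF _ this]
    have "(\<integral>\<^sup>+x. indicator {c..} x * ennreal (k * c * x powr (k - 2)) \<partial>lborel)
        = ennreal (k * c * (- (c powr (k - 2 + 1)) / (k - 2 + 1)))"
      using k c by (simp add: ennreal_mult' ennreal_indicator)
    also have "k * c * (- (c powr (k - 2 + 1)) / (k - 2 + 1)) = k / (1 - k) * c powr k"
    proof -
      have "c * c powr (k - 1) = c powr k"
        using c by (simp add: powr_diff)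
      moreover have "k * c * (- (c powr (k - 2 + 1)) / (k - 2 + 1)) = k * (c * c powr (k - 1)) / (1 - k)"
        using k by (simp add: divide_simps) (simp add: algebra_simps)
      ultimately show ?thesis by simp
    qed
    finally have upper: "(\<integral>\<^sup>+x. indicator {c..} x * ennreal (k * c * x powr (k - 2)) \<partial>lborel)
        = ennreal (k / (1 - k) * c powr k)" .
    \<comment> \<open>The two pieces on the right overlap at x = c, which an upper bound
      tolerates.\<close>
    have "(\<integral>\<^sup>+x. ennreal (k * x powr (k - 2)) * indicator {0..} x * min z (ennreal x) \<partial>lborel)
      \<le> (\<integral>\<^sup>+x. ennreal (k * x powr (k - 1)) * indicator {0..} x * indicator {x. ennreal x \<le> z} x
           + indicator {c..} x * ennreal (k * c * x powr (k - 2)) \<partial>lborel)"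
    proof (rule nn_integral_mono)
      fix x :: real
      show "ennreal (k * x powr (k - 2)) * indicator {0..} x * min z (ennreal x)
        \<le> ennreal (k * x powr (k - 1)) * indicator {0..} x * indicator {x. ennreal x \<le> z} x
           + indicator {c..} x * ennreal (k * c * x powr (k - 2))"
      proof -
        consider "x \<le> 0" | "0 < x" "x \<le> c" | "c < x"
          by linarith
        then show ?thesis
        proof cases
          case 1
          then show ?thesis
            by (cases "x = 0") auto
        next
          case 2
          have "x powr (k - 2) * x = x powr (k - 1)"
            using 2 powr_add[of x "k - 2" 1] by simp
          then have "ennreal (k * x powr (k - 2)) * ennreal x = ennreal (k * x powr (k - 1))"
            using 2 k by (simp add: ennreal_mult'' [symmetric] mult.assoc)
          then show ?thesis
            using 2 real by (simp add: min_absorb2)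
        next
          case 3
          have "ennreal (k * x powr (k - 2)) * ennreal c = ennreal (k * c * x powr (k - 2))"
            using c k by (simp add: ennreal_mult'' [symmetric] mult_ac)
          then show ?thesis
            using 3 real c by (simp add: min_absorb1)
        qed
      qed
    qed
    also have "\<dots> = ennreal_powr z k + ennreal (k / (1 - k) * c powr k)"
      using nn_integral_powr_weight_le[OF k(1), of z] upper by (subst nn_integral_add) auto
    also have "\<dots> = ennreal (1 / (1 - k)) * ennreal_powr z k"
    proof -
      have "c powr k + k / (1 - k) * c powr k = 1 / (1 - k) * c powr k"
        using k by (simp add: field_simps)
      then show ?thesis
        using k real by (simp add: ennreal_powr_def ennreal_mult' [symmetric] ennreal_plus [symmetric] del: ennreal_plus)
    qed
    finally show ?thesis .
  qed
qed

text \<open>The tail bound is multiplied by k x^(k-1) and integrated over x, and the integrals are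
  exchanged. The left side becomes the moment of Z. The first term on the right becomes the moment
  of W; the second, now with weight k x^(k-2), is at most 1/(1-k) times that moment. The constant is
  1 + 1/(1-k) = (2-k)/(1-k).\<close>

lemma (in prob_space) nn_integral_powr_le_of_tail_bound:
  assumes [measurable]: "Z \<in> borel_measurable M" "W \<in> borel_measurable M"
    and k: "0 < k" "k < 1"
    and tail: "\<And>x. 0 < x \<Longrightarrow> emeasure M {\<omega>\<in>space M. ennreal x < Z \<omega>}
      \<le> emeasure M {\<omega>\<in>space M. ennreal x \<le> W \<omega>} + ennreal (1 / x) * (\<integral>\<^sup>+\<omega>. min (W \<omega>) (ennreal x) \<partial>M)"
  shows "(\<integral>\<^sup>+\<omega>. ennreal_powr (Z \<omega>) k \<partial>M) \<le> ennreal ((2 - k) / (1 - k)) * (\<integral>\<^sup>+\<omega>. ennreal_powr (W \<omega>) k \<partial>M)"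
proof -
  interpret L: pair_sigma_finite lborel M ..
  define f where "f x = ennreal (k * x powr (k - 1)) * indicator {0..} x" for x :: real
  define g where "g x = ennreal (k * x powr (k - 2)) * indicator {0..} x" for x :: real
  have [measurable]: "f \<in> borel_measurable borel" "g \<in> borel_measurable borel"
    unfolding f_def g_def by measurable
  have "(\<integral>\<^sup>+\<omega>. ennreal_powr (Z \<omega>) k \<partial>M) = (\<integral>\<^sup>+\<omega>. \<integral>\<^sup>+x. f x * indicator {x. ennreal x < Z \<omega>} x \<partial>lborel \<partial>M)"
    unfolding f_def nn_integral_powr_weight_less[OF k(1)] ..
  also have "\<dots> = (\<integral>\<^sup>+x. \<integral>\<^sup>+\<omega>. f x * indicator {x. ennreal x < Z \<omega>} x \<partial>M \<partial>lborel)"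
    by (rule L.Fubini') measurable
  also have "\<dots> = (\<integral>\<^sup>+x. f x * emeasure M {\<omega>\<in>space M. ennreal x < Z \<omega>} \<partial>lborel)"
  proof (rule nn_integral_cong)
    fix x
    have "(\<integral>\<^sup>+\<omega>. f x * indicator {x. ennreal x < Z \<omega>} x \<partial>M)
      = (\<integral>\<^sup>+\<omega>. f x * indicator {\<omega>\<in>space M. ennreal x < Z \<omega>} \<omega> \<partial>M)"
      by (intro nn_integral_cong) (auto split: split_indicator)
    then show "(\<integral>\<^sup>+\<omega>. f x * indicator {x. ennreal x < Z \<omega>} x \<partial>M) = f x * emeasure M {\<omega>\<in>space M. ennreal x < Z \<omega>}"
      by (simp add: nn_integral_cmult_indicator)
  qed
  also have "\<dots> \<le> (\<integral>\<^sup>+x. (\<integral>\<^sup>+\<omega>. f x * indicator {x. ennreal x \<le> W \<omega>} x + g x * min (W \<omega>) (ennreal x) \<partial>M) \<partial>lborel)"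
  proof (rule nn_integral_mono)
    fix x
    show "f x * emeasure M {\<omega>\<in>space M. ennreal x < Z \<omega>}
      \<le> (\<integral>\<^sup>+\<omega>. f x * indicator {x. ennreal x \<le> W \<omega>} x + g x * min (W \<omega>) (ennreal x) \<partial>M)"
    proof (cases "0 < x")
      case False
      \<comment> \<open>At 0 the weight vanishes because \<open>0 powr a = 0\<close>, so tail bounds
        at positive levels suffice.\<close>
      then have "f x = 0"
        by (cases "x = 0") (auto simp: f_def)
      then show ?thesis by simp
    next
      case True
      have "x powr (k - 2) = x powr (k - 1) / x"
        using True powr_diff[of x "k - 1" 1] by simp
      then have g: "g x = f x * ennreal (1 / x)"
        using True k by (simp add: f_def g_def ennreal_mult'' [symmetric])
      have "f x * emeasure M {\<omega>\<in>space M. ennreal x < Z \<omega>}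
        \<le> f x * (emeasure M {\<omega>\<in>space M. ennreal x \<le> W \<omega>} + ennreal (1 / x) * (\<integral>\<^sup>+\<omega>. min (W \<omega>) (ennreal x) \<partial>M))"
        by (intro mult_left_mono tail True) simp
      also have "\<dots> = f x * emeasure M {\<omega>\<in>space M. ennreal x \<le> W \<omega>} + g x * (\<integral>\<^sup>+\<omega>. min (W \<omega>) (ennreal x) \<partial>M)"
        by (simp add: g distrib_left mult.assoc)
      also have "\<dots> = (\<integral>\<^sup>+\<omega>. f x * indicator {\<omega>\<in>space M. ennreal x \<le> W \<omega>} \<omega> + g x * min (W \<omega>) (ennreal x) \<partial>M)"
        by (simp add: nn_integral_add nn_integral_cmult nn_integral_cmult_indicator)
      also have "\<dots> = (\<integral>\<^sup>+\<omega>. f x * indicator {x. ennreal x \<le> W \<omega>} x + g x * min (W \<omega>) (ennreal x) \<partial>M)"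
        by (intro nn_integral_cong) (auto split: split_indicator)
      finally show ?thesis .
    qed
  qed
  also have "\<dots> = (\<integral>\<^sup>+\<omega>. (\<integral>\<^sup>+x. f x * indicator {x. ennreal x \<le> W \<omega>} x + g x * min (W \<omega>) (ennreal x) \<partial>lborel) \<partial>M)"
    by (rule L.Fubini'[symmetric]) measurable
  also have "\<dots> \<le> (\<integral>\<^sup>+\<omega>. ennreal ((2 - k) / (1 - k)) * ennreal_powr (W \<omega>) k \<partial>M)"
  proof (rule nn_integral_mono)
    fix \<omega>
    have "(\<integral>\<^sup>+x. f x * indicator {x. ennreal x \<le> W \<omega>} x + g x * min (W \<omega>) (ennreal x) \<partial>lborel)
      = (\<integral>\<^sup>+x. f x * indicator {x. ennreal x \<le> W \<omega>} x \<partial>lborel) + (\<integral>\<^sup>+x. g x * min (W \<omega>) (ennreal x) \<partial>lborel)"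
      by (rule nn_integral_add) measurable
    also have "\<dots> \<le> ennreal_powr (W \<omega>) k + ennreal (1 / (1 - k)) * ennreal_powr (W \<omega>) k"
      unfolding f_def g_def nn_integral_powr_weight_le[OF k(1)]
      by (intro add_left_mono nn_integral_powr_weight_min k)
    also have "\<dots> = (1 + ennreal (1 / (1 - k))) * ennreal_powr (W \<omega>) k"
      by (simp add: distrib_right)
    also have "1 + ennreal (1 / (1 - k)) = ennreal ((2 - k) / (1 - k))"
    proof -
      have "(2 - k) / (1 - k) = 1 + 1 / (1 - k)"
        using k by (simp add: field_simps)
      then show ?thesis
        using k by (simp only:) (subst ennreal_plus, auto)
    qed
    finally show "(\<integral>\<^sup>+x. f x * indicator {x. ennreal x \<le> W \<omega>} x + g x * min (W \<omega>) (ennreal x) \<partial>lborel)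
      \<le> ennreal ((2 - k) / (1 - k)) * ennreal_powr (W \<omega>) k" .
  qed
  also have "\<dots> = ennreal ((2 - k) / (1 - k)) * (\<integral>\<^sup>+\<omega>. ennreal_powr (W \<omega>) k \<partial>M)"
    by (rule nn_integral_cmult) measurable
  finally show ?thesis .
qed

section \<open>Countable suprema and the moment inequality for local martingales\<close>

lemma dyadic_point_right_of:
  fixes f :: "real \<Rightarrow> 'b::order_topology"
  assumes "0 \<le> s" "s < t" "(f \<longlongrightarrow> f s) (at_right s)" "c < f s"
  shows "\<exists>m i. s < real i / 2^m \<and> real i / 2^m < t \<and> c < f (real i / 2^m)"
proof -
  have "\<forall>\<^sub>F u in at_right s. c < f u"
    using assms(3,4) by (rule order_tendstoD)
  then obtain d where d: "s < d" "\<And>u. s < u \<Longrightarrow> u < d \<Longrightarrow> c < f u"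
    unfolding eventually_at_right_field by blast
  have "(\<lambda>m. (1/2::real)^m) \<longlonglongrightarrow> 0"
    by (rule LIMSEQ_realpow_zero) auto
  then have "\<forall>\<^sub>F m in sequentially. (1/2::real)^m < min d t - s"
    by (rule order_tendstoD) (use d(1) assms(2) in auto)
  then obtain m where m: "(1/2::real)^m < min d t - s"
    by (metis eventually_happens' sequentially_bot)
  \<comment> \<open>The successor of the floor gives the first grid point strictly to the right of
    \<open>s\<close>, even when \<open>s\<close> lies on the grid; the distance is at most
    2^(-m).\<close>
  define i where "i = Suc (nat \<lfloor>s * 2^m\<rfloor>)"
  have "real i = real_of_int \<lfloor>s * 2^m\<rfloor> + 1"
    using assms(1) by (simp add: i_def)
  then have "s * 2^m < real i" "real i \<le> s * 2^m + 1"
    by linarith+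
  then have "s < real i / 2^m" "real i / 2^m \<le> s + (1/2)^m"
    by (simp_all add: field_simps power_divide)
  then show ?thesis
    using m d(2) by (intro exI[of _ m] exI[of _ i]) auto
qed

text \<open>By right continuity, a value exceeding the dyadic supremum would force a dyadic time to
  its right with the same excess. The countable supremum has the advantage of being
  measurable.\<close>

lemma total_sup_eq_dyadic_SUP:
  assumes "\<forall>t\<ge>0. ((\<lambda>s. U s \<omega>) \<longlongrightarrow> U t \<omega>) (at_right t)"
  shows "total_sup U \<omega> = (SUP m. SUP i. ennreal (U (real i / 2^m) \<omega>))"
proof (rule antisym)
  show "total_sup U \<omega> \<le> (SUP m. SUP i. ennreal (U (real i / 2^m) \<omega>))" (is "_ \<le> ?R")
    unfolding total_sup_def
  proof (rule SUP_least, rule leI, rule notI)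
    fix t :: real assume t: "t \<in> {0..}" and less: "?R < ennreal (U t \<omega>)"
    have "((\<lambda>s. ennreal (U s \<omega>)) \<longlongrightarrow> ennreal (U t \<omega>)) (at_right t)"
      using assms t by (intro tendsto_ennrealI) auto
    then obtain m i where "?R < ennreal (U (real i / 2^m) \<omega>)"
      using dyadic_point_right_of[of t "t + 1" "\<lambda>s. ennreal (U s \<omega>)", OF _ _ _ less] t by auto
    moreover have "ennreal (U (real i / 2^m) \<omega>) \<le> ?R"
      by (rule SUP_upper2[OF UNIV_I]) (rule SUP_upper, simp)
    ultimately show False
      by simp
  qed
  show "?R \<le> total_sup U \<omega>"
    unfolding total_sup_def by (intro SUP_least) (rule SUP_upper, simp)
qed

lemma total_sup_eq_SUP_nat:
  assumes "mono_on {0..} (\<lambda>t. V t \<omega>)"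
  shows "total_sup V \<omega> = (SUP n. ennreal (V (real n) \<omega>))"
proof (rule antisym)
  show "total_sup V \<omega> \<le> (SUP n. ennreal (V (real n) \<omega>))"
    unfolding total_sup_def
  proof (rule SUP_least)
    fix t :: real assume t: "t \<in> {0..}"
    obtain n where "t \<le> real n"
      using real_arch_simple by blast
    then show "ennreal (V t \<omega>) \<le> (SUP n. ennreal (V (real n) \<omega>))"
      using mono_onD[OF assms, of t "real n"] t by (intro SUP_upper2[of n]) (auto intro: ennreal_leI)
  qed
  show "(SUP n. ennreal (V (real n) \<omega>)) \<le> total_sup V \<omega>"
    unfolding total_sup_def by (intro SUP_least) (rule SUP_upper, simp)
qed

text \<open>The tail bound comes from the case y = x: the event Z > x is split by whether W \<ge> x,
  and its part with W < x is exhausted by events over finite horizons. Z and W agree with the total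
  suprema almost surely, which is enough for the integrals.\<close>

lemma (in usual_conditions) local_martingale_domination_powr:
  assumes L: "local_martingale M F L" and L0: "AE \<omega> in M. L 0 \<omega> = 0"
    and U: "adapted F U" and V: "adapted F V"
    and U_nonneg: "AE \<omega> in M. \<forall>t\<ge>0. 0 \<le> U t \<omega>"
    and dom: "AE \<omega> in M. \<forall>t\<ge>0. U t \<omega> - V t \<omega> \<le> L t \<omega>"
    and U_rcont: "AE \<omega> in M. \<forall>t\<ge>0. ((\<lambda>s. U s \<omega>) \<longlongrightarrow> U t \<omega>) (at_right t)"
    and V_cont: "AE \<omega> in M. continuous_on {0..} (\<lambda>t. V t \<omega>)"
    and V_mono: "AE \<omega> in M. mono_on {0..} (\<lambda>t. V t \<omega>)"
    and V0: "AE \<omega> in M. V 0 \<omega> = 0"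
    and k: "0 < k" "k < 1"
  shows "(\<integral>\<^sup>+\<omega>. ennreal_powr (total_sup U \<omega>) k \<partial>M)
    \<le> ennreal ((2 - k) / (1 - k)) * (\<integral>\<^sup>+\<omega>. ennreal_powr (total_sup V \<omega>) k \<partial>M)"
proof -
  define Z where "Z \<omega> = (SUP m. SUP i. ennreal (U (real i / 2^m) \<omega>))" for \<omega>
  define W where "W \<omega> = (SUP n. ennreal (V (real n) \<omega>))" for \<omega>
  have [measurable]: "U (real i / 2^m) \<in> borel_measurable M" "V (real i) \<in> borel_measurable M" for i and m :: nat
    using adapted_borel_measurable U V by auto
  have [measurable]: "Z \<in> borel_measurable M" "W \<in> borel_measurable M"
    unfolding Z_def[abs_def] W_def[abs_def] by measurable
  have "(\<integral>\<^sup>+\<omega>. ennreal_powr (Z \<omega>) k \<partial>M) \<le> ennreal ((2 - k) / (1 - k)) * (\<integral>\<^sup>+\<omega>. ennreal_powr (W \<omega>) k \<partial>M)"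
  proof (rule nn_integral_powr_le_of_tail_bound[OF _ _ k])
    fix x :: real assume x: "0 < x"
    \<comment> \<open>Bounding W rather than V at time \<open>n\<close> makes \<open>E n\<close>
      increase with the horizon. It is contained in \<open>E' n\<close>, to which the bound for
      local martingales applies.\<close>
    define E where "E n = {\<omega>\<in>space M. (\<exists>m. \<exists>i\<le>n * 2^m. x < U (real i / 2^m) \<omega>) \<and> W \<omega> < ennreal x}" for n :: nat
    define E' where "E' n = {\<omega>\<in>space M. (\<exists>m. \<exists>i\<le>n * 2^m. x < U (real i / 2^m) \<omega>) \<and> V (real n) \<omega> < x}" for n :: nat
    have [measurable]: "E n \<in> sets M" "E' n \<in> sets M" for n
      unfolding E_def E'_def by measurable
    have bound: "emeasure M (E n) \<le> ennreal (1 / x) * (\<integral>\<^sup>+\<omega>. min (W \<omega>) (ennreal x) \<partial>M)" for n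
    proof -
      have V_less: "V (real n) \<omega> < x" if "W \<omega> < ennreal x" for \<omega>
      proof -
        have "ennreal (V (real n) \<omega>) \<le> W \<omega>"
          unfolding W_def by (rule SUP_upper) simp
        then have "ennreal (V (real n) \<omega>) < ennreal x"
          using that by (rule le_less_trans)
        then show ?thesis
          by (metis ennreal_leI not_le)
      qed
      have bdd_V: "AE \<omega> in M. 0 \<le> V n \<omega>"
        using V_mono V0 by eventually_elim (auto dest!: mono_onD[of _ _ 0 "real n"])
      have int_min: "integrable M (\<lambda>\<omega>. min (V n \<omega>) x)"
        by (rule integrable_const_bound[of _ x]) (use bdd_V x in \<open>auto simp: min_def\<close>)
      have "ennreal x * emeasure M (E n) \<le> ennreal x * emeasure M (E' n)"
        by (intro mult_left_mono emeasure_mono) (auto simp: E_def E'_def V_less)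
      also have "\<dots> = ennreal (x * prob (E' n))"
        using x by (simp add: emeasure_eq_measure ennreal_mult'')
      also have "\<dots> \<le> ennreal (\<integral>\<omega>. min (V n \<omega>) x \<partial>M)"
        unfolding E'_def
        by (intro ennreal_leI local_martingale_domination[OF L L0 U V U_nonneg dom V_cont V_mono V0 x x])
      also have "\<dots> = (\<integral>\<^sup>+\<omega>. ennreal (min (V n \<omega>) x) \<partial>M)"
        by (rule nn_integral_eq_integral[symmetric, OF int_min]) (use bdd_V x in auto)
      also have "\<dots> \<le> (\<integral>\<^sup>+\<omega>. min (W \<omega>) (ennreal x) \<partial>M)"
        unfolding W_def
        by (intro nn_integral_mono min.boundedI SUP_upper2[of n]) (auto intro!: ennreal_leI)
      finally have "ennreal (1 / x) * (ennreal x * emeasure M (E n))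
          \<le> ennreal (1 / x) * (\<integral>\<^sup>+\<omega>. min (W \<omega>) (ennreal x) \<partial>M)"
        by (rule mult_left_mono) simp
      moreover have "ennreal (1 / x) * (ennreal x * emeasure M (E n)) = emeasure M (E n)"
        using x by (simp add: mult.assoc[symmetric] ennreal_mult''[symmetric])
      ultimately show ?thesis
        by simp
    qed
    have "incseq E"
    proof (rule incseq_SucI, rule subsetI)
      fix n \<omega> assume "\<omega> \<in> E n"
      then obtain m i where *: "i \<le> n * 2^m" "x < U (real i / 2^m) \<omega>" "W \<omega> < ennreal x" "\<omega> \<in> space M"
        by (auto simp: E_def)
      then have "i \<le> Suc n * 2^m"
        by simp
      with * show "\<omega> \<in> E (Suc n)"
        unfolding E_def by blast
    qed
    have "emeasure M {\<omega>\<in>space M. ennreal x < Z \<omega>}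
      \<le> emeasure M ({\<omega>\<in>space M. ennreal x \<le> W \<omega>} \<union> (\<Union>n. E n))"
    proof (rule emeasure_mono)
      show "{\<omega>\<in>space M. ennreal x < Z \<omega>} \<subseteq> {\<omega>\<in>space M. ennreal x \<le> W \<omega>} \<union> (\<Union>n. E n)"
      proof
        fix \<omega> assume "\<omega> \<in> {\<omega>\<in>space M. ennreal x < Z \<omega>}"
        then obtain m i where \<omega>: "\<omega> \<in> space M" "ennreal x < ennreal (U (real i / 2^m) \<omega>)"
          by (auto simp: Z_def less_SUP_iff)
        then have "x < U (real i / 2^m) \<omega>"
          by (metis ennreal_leI not_le)
        \<comment> \<open>The dyadic time i/2^m is at most \<open>i\<close>, so the horizon
          \<open>i\<close> covers it.\<close>
        moreover have "i \<le> i * 2^m"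
          by simp
        ultimately have "\<omega> \<in> E i" if "W \<omega> < ennreal x"
          using \<omega>(1) that unfolding E_def by blast
        then show "\<omega> \<in> {\<omega>\<in>space M. ennreal x \<le> W \<omega>} \<union> (\<Union>n. E n)"
          using \<omega>(1) not_le by blast
      qed
    qed measurable
    also have "\<dots> \<le> emeasure M {\<omega>\<in>space M. ennreal x \<le> W \<omega>} + emeasure M (\<Union>n. E n)"
      by (rule emeasure_subadditive) measurable
    also have "emeasure M (\<Union>n. E n) = (SUP n. emeasure M (E n))"
      by (rule SUP_emeasure_incseq[symmetric]) (use \<open>incseq E\<close> in auto)
    also have "\<dots> \<le> ennreal (1 / x) * (\<integral>\<^sup>+\<omega>. min (W \<omega>) (ennreal x) \<partial>M)"
      by (intro SUP_least bound)
    finally show "emeasure M {\<omega>\<in>space M. ennreal x < Z \<omega>}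
      \<le> emeasure M {\<omega>\<in>space M. ennreal x \<le> W \<omega>} + ennreal (1 / x) * (\<integral>\<^sup>+\<omega>. min (W \<omega>) (ennreal x) \<partial>M)"
      by (simp add: add_left_mono)
  qed measurable
  moreover have "(\<integral>\<^sup>+\<omega>. ennreal_powr (Z \<omega>) k \<partial>M) = (\<integral>\<^sup>+\<omega>. ennreal_powr (total_sup U \<omega>) k \<partial>M)"
    using U_rcont by (intro nn_integral_cong_AE, eventually_elim) (simp add: Z_def total_sup_eq_dyadic_SUP)
  moreover have "(\<integral>\<^sup>+\<omega>. ennreal_powr (W \<omega>) k \<partial>M) = (\<integral>\<^sup>+\<omega>. ennreal_powr (total_sup V \<omega>) k \<partial>M)"
    using V_mono by (intro nn_integral_cong_AE, eventually_elim) (simp add: W_def total_sup_eq_SUP_nat)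
  ultimately show ?thesis
    by simp
qed

section \<open>Paths and the running supremum\<close>

text \<open>Since \<open>h\<close> is the sum only at nonnegative times, limits are transferred
  along one-sided neighbourhoods inside [0, \<infinity>); for the left limit at t this is the
  interval (0, t).\<close>

lemma cadlag_add_continuous:
  assumes f: "cadlag f" and g: "continuous_on {0..} g" and h: "\<And>t. 0 \<le> t \<Longrightarrow> h t = f t + g t"
  shows "cadlag h"
  unfolding cadlag_def
proof (intro conjI allI impI)
  have ev_right: "\<forall>\<^sub>F s in at_right t. f s + g s = h s" if "0 \<le> t" for t
    using eventually_at_right_less[of t] by eventually_elim (use that h in auto)
  have ev_left: "\<forall>\<^sub>F s in at_left t. f s + g s = h s" if "0 < t" for t
    using eventually_at_left_real[OF that] by eventually_elim (use h in auto)
  {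
    fix t :: real assume t: "0 \<le> t"
    have "(g \<longlongrightarrow> g t) (at_right t)"
      using g t by (auto simp: continuous_on intro: tendsto_within_subset)
    with f t have "((\<lambda>s. f s + g s) \<longlongrightarrow> f t + g t) (at_right t)"
      by (intro tendsto_add) (auto simp: cadlag_def)
    then show "(h \<longlongrightarrow> h t) (at_right t)"
      using tendsto_cong[OF ev_right[OF t]] h[OF t] by simp
  next
    fix t :: real assume t: "0 < t"
    have "isCont g t"
      using g t by (auto intro: continuous_on_interior)
    then have "(g \<longlongrightarrow> g t) (at_left t)"
      by (auto simp: isCont_def filterlim_at_split)
    moreover obtain l where "(f \<longlongrightarrow> l) (at_left t)"
      using f t by (auto simp: cadlag_def)
    ultimately have "((\<lambda>s. f s + g s) \<longlongrightarrow> l + g t) (at_left t)"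
      by (intro tendsto_add)
    then show "\<exists>l. (h \<longlongrightarrow> l) (at_left t)"
      using tendsto_cong[OF ev_left[OF t]] by auto
  }
qed

text \<open>In the half-line the neighbourhoods of 0 are one-sided, hence the left condition is
  asked for only when t > 0.\<close>

lemma eventually_within_nonneg:
  fixes t :: real
  assumes "\<forall>\<^sub>F s in at_right t. P s" and "0 < t \<Longrightarrow> \<forall>\<^sub>F s in at_left t. P s" and "0 \<le> t"
  shows "\<forall>\<^sub>F s in at t within {0..}. P s"
proof (cases "t = 0")
  case True
  have "at t within {0..} = at_right t"
    unfolding True by (rule at_within_nhd[of _ UNIV]) auto
  then show ?thesis
    using assms(1) by simp
next
  case False
  then have "\<forall>\<^sub>F s in at t. P s"
    using assms by (simp add: eventually_at_split)
  then show ?thesis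
    by (rule filter_leD[OF at_le, rotated]) simp
qed

text \<open>One-sided limits bound the path near each point, and compactness of [0, t] leaves
  finitely many such bounds.\<close>

lemma bdd_above_cadlag:
  assumes "cadlag f"
  shows "bdd_above (f ` {0..t})"
proof -
  have "\<exists>S C. open S \<and> s \<in> S \<and> (\<forall>u\<in>S \<inter> {0..t}. f u \<le> C)" if s: "s \<in> {0..t}" for s
  proof -
    have "\<forall>\<^sub>F u in at_right s. f u < f s + 1"
      using assms s by (intro order_tendstoD(2)) (auto simp: cadlag_def)
    \<comment> \<open>The guard \<open>0 < s\<close> lets s = 0 be treated alike: there
      \<open>l\<close> is arbitrary and can only enlarge the local bound.\<close>
    moreover obtain l where "0 < s \<longrightarrow> (f \<longlongrightarrow> l) (at_left s)"
      using assms by (auto simp: cadlag_def)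
    then have "0 < s \<Longrightarrow> \<forall>\<^sub>F u in at_left s. f u < l + 1"
      by (intro order_tendstoD(2)) auto
    ultimately have "\<forall>\<^sub>F u in at s within {0..}. f u \<le> max (f s) l + 1"
      using s by (intro eventually_within_nonneg) (auto elim!: eventually_mono)
    then obtain S where "open S" "s \<in> S" "\<And>u. u \<in> S \<Longrightarrow> u \<noteq> s \<Longrightarrow> 0 \<le> u \<Longrightarrow> f u \<le> max (f s) l + 1"
      unfolding eventually_at_topological by auto
    then show ?thesis
      by (intro exI[of _ S] exI[of _ "max (f s) l + 1"]) (auto, smt (verit))
  qed
  then obtain S C where SC: "\<And>s. s \<in> {0..t} \<Longrightarrow> open (S s) \<and> s \<in> S s \<and> (\<forall>u\<in>S s \<inter> {0..t}. f u \<le> C s)"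
    by metis
  have "compact {0..t}"
    by simp
  then obtain I where I: "I \<subseteq> {0..t}" "finite I" "{0..t} \<subseteq> (\<Union>s\<in>I. S s)"
    by (rule compactE_image[of _ "{0..t}" S]) (use SC in auto)
  show ?thesis
  proof (rule bdd_aboveI2)
    fix u assume u: "u \<in> {0..t}"
    then obtain s where "s \<in> I" "u \<in> S s"
      using I by blast
    then have "f u \<le> C s"
      using SC[of s] I(1) u by blast
    \<comment> \<open>The sum of absolute values stands in for the maximum of the finitely many
      bounds.\<close>
    also have "C s \<le> (\<Sum>s\<in>I. \<bar>C s\<bar>)"
      using member_le_sum[of s I "\<lambda>s. \<bar>C s\<bar>"] I(2) \<open>s \<in> I\<close> by auto
    finally show "f u \<le> (\<Sum>s\<in>I. \<bar>C s\<bar>)" .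
  qed
qed

lemma mono_on_running_sup:
  assumes "\<And>t. bdd_above ((\<lambda>s. X s \<omega>) ` {0..t})"
  shows "mono_on {0..} (\<lambda>t. running_sup X t \<omega>)"
  unfolding running_sup_def using assms by (intro mono_onI cSUP_subset_mono) auto

lemma le_running_sup:
  assumes "\<And>t. bdd_above ((\<lambda>s. X s \<omega>) ` {0..t})" "0 \<le> s" "s \<le> t"
  shows "X s \<omega> \<le> running_sup X t \<omega>"
  unfolding running_sup_def using assms by (intro cSUP_upper) auto

lemma total_sup_running_sup:
  assumes bdd: "\<And>t. bdd_above ((\<lambda>s. X s \<omega>) ` {0..t})" and nonneg: "\<And>t. 0 \<le> t \<Longrightarrow> 0 \<le> X t \<omega>"
  shows "total_sup (running_sup X) \<omega> = total_sup X \<omega>"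
proof (rule antisym)
  show "total_sup X \<omega> \<le> total_sup (running_sup X) \<omega>"
    unfolding total_sup_def
    by (rule SUP_mono) (use le_running_sup[where X = X and \<omega> = \<omega>, OF bdd] in \<open>auto intro!: ennreal_leI\<close>)
  show "total_sup (running_sup X) \<omega> \<le> total_sup X \<omega>"
  proof (cases "total_sup X \<omega>")
    case (real c)
    have "X s \<omega> \<le> c" if "0 \<le> s" for s
    proof -
      have "ennreal (X s \<omega>) \<le> ennreal c"
        unfolding real(2)[symmetric] total_sup_def by (rule SUP_upper) (use that in simp)
      then show ?thesis
        using real nonneg[OF that] by simp
    qed
    then have "running_sup X t \<omega> \<le> c" if "0 \<le> t" for t
      unfolding running_sup_def using that by (intro cSUP_least) auto
    then show ?thesis
      unfolding real(2) total_sup_def[of "running_sup X"] by (intro SUP_least ennreal_leI) auto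
  qed simp
qed

text \<open>A monotone path can fail to be continuous at t only by rising abruptly just after t,
  which right continuity of X excludes, or by jumping up on arrival at t, which would need an upward
  jump of X itself.\<close>

lemma continuous_on_running_sup:
  assumes cadlag: "cadlag (\<lambda>t. X t \<omega>)" and neg: "only_negative_jumps (\<lambda>t. X t \<omega>)"
  shows "continuous_on {0..} (\<lambda>t. running_sup X t \<omega>)"
  unfolding continuous_on
proof (intro ballI order_tendstoI)
  note bdd = bdd_above_cadlag[OF cadlag]
  note mono = mono_onD[OF mono_on_running_sup[where X = X and \<omega> = \<omega>, OF bdd]]
  fix t a :: real assume "t \<in> {0..}"
  then have t: "0 \<le> t" by simp
  {
    assume a: "running_sup X t \<omega> < a"
    have "\<forall>\<^sub>F s in at_right t. running_sup X s \<omega> < a"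
    proof -
      \<comment> \<open>Keeping X below a level bounds the supremum only weakly by that level, hence
        an intermediate \<open>b\<close> strictly below \<open>a\<close>.\<close>
      obtain b where b: "running_sup X t \<omega> < b" "b < a"
        using dense[OF a] by blast
      have "X t \<omega> < b"
        using le_running_sup[where X = X and \<omega> = \<omega>, OF bdd t order_refl] b(1) by simp
      then have "\<forall>\<^sub>F s in at_right t. X s \<omega> < b"
        using cadlag t by (intro order_tendstoD(2)) (auto simp: cadlag_def)
      then obtain d where d: "t < d" "\<And>s. t < s \<Longrightarrow> s < d \<Longrightarrow> X s \<omega> < b"
        unfolding eventually_at_right_field by blast
      show ?thesis
        unfolding eventually_at_right_field
      proof (intro exI[of _ d] conjI allI impI d(1))
        fix s assume s: "t < s" "s < d"
        have "X u \<omega> \<le> b" if "u \<in> {0..s}" for u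
        proof (cases "u \<le> t")
          case True
          then show ?thesis
            using le_running_sup[where X = X and \<omega> = \<omega>, OF bdd, of u t] that b by simp
        qed (use d(2)[of u] that s in auto)
        then have "running_sup X s \<omega> \<le> b"
          unfolding running_sup_def using s t by (intro cSUP_least) auto
        then show "running_sup X s \<omega> < a"
          using b(2) by simp
      qed
    qed
    moreover have "\<forall>\<^sub>F s in at_left t. running_sup X s \<omega> < a" if "0 < t"
      using eventually_at_left_real[OF that]
    proof eventually_elim
      case (elim s)
      then show ?case
        using mono[of s t] a by simp
    qed
    ultimately show "\<forall>\<^sub>F s in at t within {0..}. running_sup X s \<omega> < a"
      using t by (rule eventually_within_nonneg)
  next
    assume a: "a < running_sup X t \<omega>"
    have "\<forall>\<^sub>F s in at_right t. a < running_sup X s \<omega>"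
      using eventually_at_right_less[of t]
    proof eventually_elim
      case (elim s)
      then show ?case
        using mono[of t s] a t by simp
    qed
    moreover have "\<forall>\<^sub>F s in at_left t. a < running_sup X s \<omega>" if "0 < t"
    proof -
      obtain u where u: "0 \<le> u" "u \<le> t" "a < X u \<omega>"
        using a t unfolding running_sup_def by (subst (asm) less_cSUP_iff) (auto intro: bdd)
      show ?thesis
      proof (cases "u < t")
        case True
        show ?thesis
          using eventually_at_left_real[OF True]
        proof eventually_elim
          case (elim s)
          then show ?case
            using le_running_sup[where X = X and \<omega> = \<omega>, OF bdd, of u s] u by simp
        qed
      next
        case False
        \<comment> \<open>Here u = t. Without an upward jump the left limit is at least X_t > a, so
          X exceeds \<open>a\<close> already shortly before t.\<close>
        obtain l where l: "((\<lambda>s. X s \<omega>) \<longlongrightarrow> l) (at_left t)"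
          using cadlag \<open>0 < t\<close> by (auto simp: cadlag_def)
        have "Lim (at_left t) (\<lambda>s. X s \<omega>) = l"
          by (rule tendsto_Lim[OF _ l]) simp
        then have "a < l"
          using neg False u \<open>0 < t\<close> by (auto simp: only_negative_jumps_def)
        from order_tendstoD(1)[OF l this] eventually_at_left_real[OF \<open>0 < t\<close>] show ?thesis
        proof eventually_elim
          case (elim s)
          then show ?case
            using le_running_sup[where X = X and \<omega> = \<omega>, OF bdd, of s s] by simp
        qed
      qed
    qed
    ultimately show "\<forall>\<^sub>F s in at t within {0..}. a < running_sup X s \<omega>"
      using t by (rule eventually_within_nonneg)
  }
qed

text \<open>\<open>Lim\<close> is a description, so its value is obtained by proving convergence: an
  increasing path tends to its supremum.\<close>

lemma limit_at_infinity_eq_total_sup: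
  assumes "mono_on {0..} (\<lambda>t. A t \<omega>)"
  shows "limit_at_infinity A \<omega> = total_sup A \<omega>"
  unfolding limit_at_infinity_def
proof (rule tendsto_Lim)
  show "((\<lambda>t. ennreal (A t \<omega>)) \<longlongrightarrow> total_sup A \<omega>) at_top"
  proof (rule order_tendstoI)
    fix a assume "a < total_sup A \<omega>"
    then obtain s where s: "0 \<le> s" "a < ennreal (A s \<omega>)"
      by (auto simp: total_sup_def less_SUP_iff)
    show "\<forall>\<^sub>F t in at_top. a < ennreal (A t \<omega>)"
      using eventually_ge_at_top[of s]
    proof eventually_elim
      case (elim t)
      then have "ennreal (A s \<omega>) \<le> ennreal (A t \<omega>)"
        using s(1) mono_onD[OF assms, of s t] by (intro ennreal_leI) auto
      with s(2) show ?case
        by (rule less_le_trans)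
    qed
  next
    fix a assume a: "total_sup A \<omega> < a"
    show "\<forall>\<^sub>F t in at_top. ennreal (A t \<omega>) < a"
      using eventually_ge_at_top[of 0]
    proof eventually_elim
      case (elim t)
      then have "ennreal (A t \<omega>) \<le> total_sup A \<omega>"
        unfolding total_sup_def by (intro SUP_upper) simp
      then show ?case
        using a by (rule le_less_trans)
    qed
  qed
qed simp

section \<open>Adaptedness of the running supremum, and change of sign\<close>

context usual_conditions
begin

text \<open>\<open>R\<close> arises from \<open>S\<close> by adding one null set and removing
  another. Completeness makes both differences measurable, and the usual conditions place all null
  sets in \<open>F 0\<close>, hence in \<open>F t\<close>.\<close>

lemma sets_F_AE_eq:
  assumes t: "0 \<le> t" and S: "S \<in> sets (F t)" and R: "R \<subseteq> space M"
    and ae: "AE \<omega> in M. \<omega> \<in> S \<longleftrightarrow> \<omega> \<in> R"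
  shows "R \<in> sets (F t)"
proof -
  interpret complete_measure M
    by (rule complete)
  have null: "N \<in> sets (F t)" if "N \<in> null_sets M" for N
    using that null_sets_F F_mono[of 0 t] t by auto
  have SM: "S \<subseteq> space M"
    using sets.sets_into_space[OF S] space_F[OF t] by simp
  have "AE \<omega> in M. \<omega> \<notin> R - S" "AE \<omega> in M. \<omega> \<notin> S - R"
    using ae by (eventually_elim, auto)+
  then have "R - S \<in> null_sets M" "S - R \<in> null_sets M"
    using R SM unfolding null_sets_iff_AE by auto
  then have "S \<union> (R - S) - (S - R) \<in> sets (F t)"
    using S null by blast
  also have "S \<union> (R - S) - (S - R) = R"
    by auto
  finally show ?thesis .
qed

text \<open>Right continuity reduces an upper bound over [0, t] to countably many times. The paths
  are cadlag only almost surely, so the two events may differ on a null set, which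
  \<open>sets_F_AE_eq\<close> absorbs.\<close>

lemma adapted_running_sup:
  assumes X: "adapted F X" and cadlag: "AE \<omega> in M. cadlag (\<lambda>t. X t \<omega>)"
  shows "adapted F (running_sup X)"
  unfolding adapted_def
proof (intro allI impI)
  fix t :: real assume t: "0 \<le> t"
  \<comment> \<open>The endpoint \<open>t\<close> is adjoined because dyadic points to its right lie
    beyond the horizon.\<close>
  define D where "D = insert t {u. (\<exists>m i. u = real i / 2^m) \<and> u \<le> t}"
  have "D = insert t ((\<Union>m. range (\<lambda>i. real i / 2^m)) \<inter> {..t})"
    by (auto simp: D_def)
  then have D_countable: "countable D"
    by (simp add: countable_Int1)
  have D: "0 \<le> u \<and> u \<le> t" if "u \<in> D" for u
    using that t by (auto simp: D_def)
  show "running_sup X t \<in> borel_measurable (F t)"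
    unfolding borel_measurable_iff_le
  proof
    fix c
    show "{\<omega>\<in>space (F t). running_sup X t \<omega> \<le> c} \<in> sets (F t)"
      unfolding space_F[OF t]
    proof (rule sets_F_AE_eq[OF t])
      have "(\<Inter>u\<in>D. {\<omega>\<in>space (F t). X u \<omega> \<le> c}) \<in> sets (F t)"
      proof (rule sets.countable_INT'[OF D_countable])
        show "D \<noteq> {}"
          by (simp add: D_def)
        show "(\<lambda>u. {\<omega>\<in>space (F t). X u \<omega> \<le> c}) ` D \<subseteq> sets (F t)"
        proof safe
          fix u assume "u \<in> D"
          then have "X u \<in> borel_measurable (F t)"
            using D adapted_borel_measurable_mono[OF X] by blast
          then show "{\<omega>\<in>space (F t). X u \<omega> \<le> c} \<in> sets (F t)"
            by measurable
        qed
      qed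
      also have "(\<Inter>u\<in>D. {\<omega>\<in>space (F t). X u \<omega> \<le> c}) = {\<omega>\<in>space (F t). \<forall>u\<in>D. X u \<omega> \<le> c}"
        by (auto simp: D_def)
      finally show "{\<omega>\<in>space (F t). \<forall>u\<in>D. X u \<omega> \<le> c} \<in> sets (F t)" .
      show "AE \<omega> in M. \<omega> \<in> {\<omega>\<in>space (F t). \<forall>u\<in>D. X u \<omega> \<le> c} \<longleftrightarrow> \<omega> \<in> {\<omega>\<in>space M. running_sup X t \<omega> \<le> c}"
        using cadlag
      proof eventually_elim
        case (elim \<omega>)
        note bdd = bdd_above_cadlag[OF elim]
        have "(\<forall>u\<in>D. X u \<omega> \<le> c) \<longleftrightarrow> (\<forall>u\<in>{0..t}. X u \<omega> \<le> c)"
        proof safe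
          fix u assume *: "\<forall>u\<in>D. X u \<omega> \<le> c" "u \<in> {0..t}"
          show "X u \<omega> \<le> c"
          proof (rule ccontr)
            assume "\<not> X u \<omega> \<le> c"
            moreover from this * have "u \<noteq> t"
              by (auto simp: D_def)
            ultimately obtain m i where "real i / 2^m < t" "c < X (real i / 2^m) \<omega>"
              using dyadic_point_right_of[of u t "\<lambda>s. X s \<omega>" c] elim *(2) by (auto simp: cadlag_def)
            moreover from this have "real i / 2^m \<in> D"
              by (auto simp: D_def)
            ultimately show False
              using *(1) by auto
          qed
        qed (use D in auto)
        also have "\<dots> \<longleftrightarrow> running_sup X t \<omega> \<le> c"
          unfolding running_sup_def using t bdd by (subst cSUP_le_iff) auto
        finally show ?case
          using space_F[OF t] by simp
      qed
    qed auto
  qed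
qed

lemma martingale_uminus:
  assumes "martingale M F L"
  shows "martingale M F (\<lambda>t \<omega>. - L t \<omega>)"
  unfolding martingale_def
proof (intro conjI allI impI)
  show "adapted F (\<lambda>t \<omega>. - L t \<omega>)"
    using assms by (auto simp: martingale_def adapted_def)
  show "integrable M (\<lambda>\<omega>. - L t \<omega>)" if "0 \<le> t" for t
    using assms that by (auto simp: martingale_def)
  fix s t :: real assume st: "0 \<le> s \<and> s \<le> t"
  interpret finite_measure_subalgebra M "F s"
    by unfold_locales (use subalgebra_F st in auto)
  have "integrable M (L t)" "AE \<omega> in M. real_cond_exp M (F s) (L t) \<omega> = L s \<omega>"
    using assms st by (auto simp: martingale_def)
  from real_cond_exp_cmult[OF this(1), of "-1"] this(2)
  show "AE \<omega> in M. real_cond_exp M (F s) (\<lambda>\<omega>. - L t \<omega>) \<omega> = - L s \<omega>"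
    by eventually_elim simp
qed

text \<open>The second bound needs -N as a local martingale; the same localizing sequence
  serves.\<close>

lemma local_martingale_uminus:
  assumes "local_martingale M F L"
  shows "local_martingale M F (\<lambda>t \<omega>. - L t \<omega>)"
proof -
  obtain T where T: "\<forall>n. extended_stopping_time F (T n)"
    "AE \<omega> in M. incseq (\<lambda>n. T n \<omega>) \<and> (\<lambda>n. T n \<omega>) \<longlonglongrightarrow> \<infinity>"
    "\<And>n. martingale M F (\<lambda>t \<omega>. if T n \<omega> > 0 then stopped L (T n) t \<omega> else 0)"
    using assms unfolding local_martingale_def locally_in_def by auto
  have "martingale M F (\<lambda>t \<omega>. if T n \<omega> > 0 then stopped (\<lambda>t \<omega>. - L t \<omega>) (T n) t \<omega> else 0)" for n
    using martingale_uminus[OF T(3)[of n]] by (simp add: stopped_def if_distrib cong: if_cong)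
  moreover have "adapted F (\<lambda>t \<omega>. - L t \<omega>)"
    using assms by (auto simp: local_martingale_def adapted_def)
  ultimately show ?thesis
    using T(1,2) unfolding local_martingale_def locally_in_def by blast
qed

end

section \<open>The two moment bounds for X and A\<close>

theorem proposition3p14:
  fixes M :: "'a measure" and F :: "real \<Rightarrow> 'a measure"
    and X N A :: "real \<Rightarrow> 'a \<Rightarrow> real"
  assumes "usual_conditions M F"
    and X_submart: "local_submartingale M F X"
    and X_nonneg: "AE \<omega> in M. \<forall>t\<ge>0. 0 \<le> X t \<omega>"
    and decomp: "AE \<omega> in M. \<forall>t\<ge>0. X t \<omega> = N t \<omega> + A t \<omega>"
    and N_mart: "local_martingale M F N"
    and N_cadlag: "AE \<omega> in M. cadlag (\<lambda>t. N t \<omega>)"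
    and N_0: "AE \<omega> in M. N 0 \<omega> = 0"
    and A_adapted: "adapted F A"
    and A_cont: "AE \<omega> in M. continuous_on {0..} (\<lambda>t. A t \<omega>)"
    and A_incr: "AE \<omega> in M. mono_on {0..} (\<lambda>t. A t \<omega>)"
    and A_0: "AE \<omega> in M. A 0 \<omega> = 0"
  shows "(\<forall>k::real. 0 < k \<and> k < 1 \<longrightarrow>
            (\<integral>\<^sup>+\<omega>. ennreal_powr (total_sup X \<omega>) k \<partial>M)
              \<le> ennreal ((2 - k) / (1 - k)) * (\<integral>\<^sup>+\<omega>. ennreal_powr (limit_at_infinity A \<omega>) k \<partial>M)) \<and>
         ((AE \<omega> in M. continuous_on {0..} (\<lambda>t. running_sup X t \<omega>)) \<longrightarrow>
            (\<forall>k::real. 0 < k \<and> k < 1 \<longrightarrow>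
              (\<integral>\<^sup>+\<omega>. ennreal_powr (total_sup X \<omega>) k \<partial>M)
                \<le> ennreal ((2 - k) / (1 - k)) * (\<integral>\<^sup>+\<omega>. ennreal_powr (limit_at_infinity A \<omega>) k \<partial>M) \<and>
              ennreal ((2 - k) / (1 - k)) * (\<integral>\<^sup>+\<omega>. ennreal_powr (limit_at_infinity A \<omega>) k \<partial>M)
                \<le> ennreal (((2 - k) / (1 - k))\<^sup>2) * (\<integral>\<^sup>+\<omega>. ennreal_powr (total_sup X \<omega>) k \<partial>M))) \<and>
         ((AE \<omega> in M. only_negative_jumps (\<lambda>t. X t \<omega>)) \<longrightarrow>
            (AE \<omega> in M. continuous_on {0..} (\<lambda>t. running_sup X t \<omega>)))"
proof -
  interpret usual_conditions M F
    by fact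
  have X_adapted: "adapted F X"
    using X_submart by (simp add: local_submartingale_def)
  have X_cadlag: "AE \<omega> in M. cadlag (\<lambda>t. X t \<omega>)"
    using N_cadlag A_cont decomp
    by eventually_elim (rule cadlag_add_continuous, auto)
  have A_nonneg: "AE \<omega> in M. \<forall>t\<ge>0. 0 \<le> A t \<omega>"
    using A_incr A_0 by eventually_elim (auto dest: mono_onD[of _ _ 0])
  have A_limit: "(\<integral>\<^sup>+\<omega>. ennreal_powr (limit_at_infinity A \<omega>) k \<partial>M) = (\<integral>\<^sup>+\<omega>. ennreal_powr (total_sup A \<omega>) k \<partial>M)" for k
    using A_incr by (intro nn_integral_cong_AE, eventually_elim) (simp add: limit_at_infinity_eq_total_sup)
  have X_le_A: "(\<integral>\<^sup>+\<omega>. ennreal_powr (total_sup X \<omega>) k \<partial>M)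
      \<le> ennreal ((2 - k) / (1 - k)) * (\<integral>\<^sup>+\<omega>. ennreal_powr (limit_at_infinity A \<omega>) k \<partial>M)"
    if k: "0 < k" "k < 1" for k
    unfolding A_limit
  proof (rule local_martingale_domination_powr[OF N_mart N_0 X_adapted A_adapted X_nonneg _ _ A_cont A_incr A_0 k])
    show "AE \<omega> in M. \<forall>t\<ge>0. X t \<omega> - A t \<omega> \<le> N t \<omega>"
      using decomp by eventually_elim auto
    show "AE \<omega> in M. \<forall>t\<ge>0. ((\<lambda>s. X s \<omega>) \<longlongrightarrow> X t \<omega>) (at_right t)"
      using X_cadlag by eventually_elim (auto simp: cadlag_def)
  qed
  have A_le_X: "(\<integral>\<^sup>+\<omega>. ennreal_powr (limit_at_infinity A \<omega>) k \<partial>M)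
      \<le> ennreal ((2 - k) / (1 - k)) * (\<integral>\<^sup>+\<omega>. ennreal_powr (total_sup X \<omega>) k \<partial>M)"
    if k: "0 < k" "k < 1" and cont: "AE \<omega> in M. continuous_on {0..} (\<lambda>t. running_sup X t \<omega>)" for k
  proof -
    have "(\<integral>\<^sup>+\<omega>. ennreal_powr (total_sup A \<omega>) k \<partial>M)
      \<le> ennreal ((2 - k) / (1 - k)) * (\<integral>\<^sup>+\<omega>. ennreal_powr (total_sup (running_sup X) \<omega>) k \<partial>M)"
    \<comment> \<open>The assumed continuity of the running supremum permits it in the role of V,
      with A in the role of U.\<close>
    proof (rule local_martingale_domination_powr[OF local_martingale_uminus[OF N_mart] _ A_adapted
          adapted_running_sup[OF X_adapted X_cadlag] A_nonneg _ _ cont _ _ k])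
      show "AE \<omega> in M. - N 0 \<omega> = 0"
        using N_0 by eventually_elim simp
      show "AE \<omega> in M. \<forall>t\<ge>0. A t \<omega> - running_sup X t \<omega> \<le> - N t \<omega>"
        using X_cadlag decomp
      proof eventually_elim
        case (elim \<omega>)
        show ?case
          using le_running_sup[where X = X and \<omega> = \<omega>, OF bdd_above_cadlag[OF elim(1)]] elim(2) by (smt (verit))
      qed
      show "AE \<omega> in M. \<forall>t\<ge>0. ((\<lambda>s. A s \<omega>) \<longlongrightarrow> A t \<omega>) (at_right t)"
        using A_cont
        by eventually_elim (auto simp: continuous_on intro: tendsto_within_subset)
      show "AE \<omega> in M. mono_on {0..} (\<lambda>t. running_sup X t \<omega>)"
        using X_cadlag by eventually_elim (rule mono_on_running_sup, rule bdd_above_cadlag)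
      \<comment> \<open>The supremum over {0} is X_0 = N_0 + A_0 = 0.\<close>
      show "AE \<omega> in M. running_sup X 0 \<omega> = 0"
        using decomp N_0 A_0 by eventually_elim (simp add: running_sup_def)
    qed
    also have "(\<integral>\<^sup>+\<omega>. ennreal_powr (total_sup (running_sup X) \<omega>) k \<partial>M) = (\<integral>\<^sup>+\<omega>. ennreal_powr (total_sup X \<omega>) k \<partial>M)"
      using X_cadlag X_nonneg
      by (intro nn_integral_cong_AE, eventually_elim) (simp add: total_sup_running_sup bdd_above_cadlag)
    finally show ?thesis
      unfolding A_limit .
  qed
  show ?thesis
  proof (intro conjI allI impI)
    fix k :: real
    assume cont: "AE \<omega> in M. continuous_on {0..} (\<lambda>t. running_sup X t \<omega>)" and k: "0 < k \<and> k < 1"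
    have "ennreal ((2 - k) / (1 - k)) * (\<integral>\<^sup>+\<omega>. ennreal_powr (limit_at_infinity A \<omega>) k \<partial>M)
      \<le> ennreal ((2 - k) / (1 - k)) * (ennreal ((2 - k) / (1 - k)) * (\<integral>\<^sup>+\<omega>. ennreal_powr (total_sup X \<omega>) k \<partial>M))"
      using k by (intro mult_left_mono A_le_X cont) auto
    also have "\<dots> = ennreal (((2 - k) / (1 - k))\<^sup>2) * (\<integral>\<^sup>+\<omega>. ennreal_powr (total_sup X \<omega>) k \<partial>M)"
      using k by (subst ennreal_power[symmetric]) (auto simp: power2_eq_square mult.assoc)
    finally show "ennreal ((2 - k) / (1 - k)) * (\<integral>\<^sup>+\<omega>. ennreal_powr (limit_at_infinity A \<omega>) k \<partial>M)
      \<le> ennreal (((2 - k) / (1 - k))\<^sup>2) * (\<integral>\<^sup>+\<omega>. ennreal_powr (total_sup X \<omega>) k \<partial>M)" .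
  next
    assume "AE \<omega> in M. only_negative_jumps (\<lambda>t. X t \<omega>)"
    with X_cadlag show "AE \<omega> in M. continuous_on {0..} (\<lambda>t. running_sup X t \<omega>)"
      by eventually_elim (rule continuous_on_running_sup)
  qed (use X_le_A in auto)
qed

end
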